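(* For $k\ge1$, $\ell\ge 0$ and $\lambda\in\mathrm{Par}^k_\ell$, we have $G_{1^\ell}^\perp\,\mathfrak g^{(k+1)}_{\lambda+1^\ell}=\mathfrak g^{(k)}_\lambda$, where $G_{1^\ell}=\sum_{i\ge0}(-1)^i\binom{\ell-1+i}{\ell-1}e_{\ell+i}$. Consequently also $G_{1^\ell}^\perp\,g^{(k+1)}_{\lambda+1^\ell}=g^{(k)}_\lambda$.
   Context: Let $\Lambda=\mathbb Z[h_1,h_2,\dots]$ be the ring of symmetric functions, with $h_d$, $e_d$ the complete homogeneous and elementary symmetric functions, $h_0=1$, $h_d=0$ for $d<0$. For $f\in\Lambda$, $f^\perp$ is the adjoint of multiplication by $f$ for the Hall inner product (Schur functions orthonormal); for a formal sum $f=\sum_{i\ge0}c_ie_{m+i}$ set $f^\perp=\sum_i c_ie_{m+i}^\perp$ (finite on each element of $\Lambda$). For $m,r\in\mathbb Z$ set $k_m^{(r)}=\sum_{i=0}^m\binom{r+i-1}{i}h_{m-i}$ ($\binom n0=1$, $\binom ni=n(n-1)\cdots(n-i+1)/i!$). For $\gamma\in\mathbb Z^\ell$ let $g_\gamma=\det(k^{(i-1)}_{\gamma_i+j-i})_{1\le i,j\le\ell}$. Let $\Delta^+_\ell=\{(i,j):1\le i<j\le\ell\}$. For $\Psi,\mathcal L\subset\Delta^+_\ell$ and $\gamma\in\mathbb Z^\ell$, define $K(\Psi;\mathcal L;\gamma)=g\big(\prod_{(i,j)\in\Psi}(1-z_i/z_j)^{-1}\prod_{(i,j)\in\mathcal L}(1-1/z_j)\mathbf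 z^\gamma\big)$, where the expression is expanded in $\mathbb Z[[z_1/z_2,\dots,z_{\ell-1}/z_\ell]][z_1^{\pm1},\dots,z_\ell^{\pm1}]$ and $g$ is the additive map $\mathbf z^\gamma\mapsto g_\gamma$. Let $\mathrm{Par}^k_\ell=\{\mu\in\mathbb Z^\ell:k\ge\mu_1\ge\dots\ge\mu_\ell\ge0\}$; for $\mu\in\mathrm{Par}^k_\ell$ and $m\ge1$ set $\Delta^m(\mu)=\{(i,j)\in\Delta^+_\ell:m-\mu_i+i<j\}$, and $\mathfrak g^{(k)}_\mu=K(\Delta^k(\mu);\Delta^{k+1}(\mu);\mu)$. Also $\lambda+1^\ell=(\lambda_1+1,\dots,\lambda_\ell+1)$. The $g^{(k)}_\lambda$ are the $K$-$k$-Schur functions of Lam–Schilling–Shimozono (the $K$-homology Schubert representatives for the affine Grassmannian of $SL_{k+1}$), which are known to equal $\mathfrak g^{(k)}_\lambda$ for $\lambda\in\mathrm{Par}^k$. *)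

theory Defs
  imports "HOL-Library.Poly_Mapping" "Jordan_Normal_Form.Determinant"
begin

(* The polynomial ring Z[h_1, h_2, ...]; the variable with index i stands for h_(i+1). *)
type_synonym symf = "(nat \<Rightarrow>\<^sub>0 nat) \<Rightarrow>\<^sub>0 int"

definition hsym :: "int \<Rightarrow> symf" where
  "hsym d = (if d < 0 then 0 else if d = 0 then 1
             else Poly_Mapping.single (Poly_Mapping.single (nat d - 1) 1) 1)"

(* Solves the relations sum_(i=0..d) (-1)^i h_i e_(d-i) = 0 for d >= 1. *)
fun esym :: "nat \<Rightarrow> symf" where
  "esym 0 = 1"
| "esym (Suc d) = (\<Sum>i\<in>{0..d}. (-1) ^ i * hsym (int i + 1) * esym (d - i))"

section \<open>Hall inner product and adjoints\<close>

definition partitions :: "nat list set" where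
  "partitions = {p. sorted_wrt (\<ge>) p \<and> 0 \<notin> set p}"

(* Jacobi-Trudi; rows and columns are numbered from 0, which leaves j - i unchanged. *)
definition schur :: "nat list \<Rightarrow> symf" where
  "schur p = det (mat (length p) (length p) (\<lambda>(i, j). hsym (int (p ! i) + int j - int i)))"

definition is_hall_form :: "(symf \<Rightarrow> symf \<Rightarrow> int) \<Rightarrow> bool" where
  "is_hall_form B \<longleftrightarrow>
     (\<forall>a b c. B (a + b) c = B a c + B b c) \<and>
     (\<forall>a b c. B a (b + c) = B a b + B a c) \<and>
     (\<forall>p\<in>partitions. \<forall>q\<in>partitions. B (schur p) (schur q) = (if p = q then 1 else 0))"

definition hall :: "symf \<Rightarrow> symf \<Rightarrow> int" where
  "hall = (THE B. is_hall_form B)"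

definition perp :: "symf \<Rightarrow> symf \<Rightarrow> symf" where
  "perp f a = (THE b. \<forall>c. hall b c = hall a (f * c))"

(* The operator adjoint to the formal sum of c_i e_(m+i) over i >= 0; only finitely many summands
   are nonzero on a given a, and Sum_any sums the nonzero ones. *)
definition perp_esum :: "nat \<Rightarrow> (nat \<Rightarrow> int) \<Rightarrow> symf \<Rightarrow> symf" where
  "perp_esum m c a = Sum_any (\<lambda>i. of_int (c i) * perp (esym (m + i)) a)"

(* Coefficient of e_(l+i) in G_(1^l).  For l = 0 the lower index of the binomial coefficient is -1;
   binom(i-1,-1) is read as binom(i-1,i), so that G_(1^0) = 1. *)
definition G_col_coeff :: "nat \<Rightarrow> nat \<Rightarrow> int" where
  "G_col_coeff l i =
     (if l = 0 then (if i = 0 then 1 else 0) else (-1) ^ i * int ((l - 1 + i) choose (l - 1)))"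

definition G_col_perp :: "nat \<Rightarrow> symf \<Rightarrow> symf" where
  "G_col_perp l = perp_esum l (G_col_coeff l)"

section \<open>Katalan functions\<close>

(* n(n-1)...(n-i+1)/i!, an exact division. *)
definition int_binom :: "int \<Rightarrow> nat \<Rightarrow> int" where
  "int_binom n i = (\<Prod>j<i. n - int j) div fact i"

(* kcomp r m is k_m^(r); the sum is empty for m < 0. *)
definition kcomp :: "int \<Rightarrow> int \<Rightarrow> symf" where
  "kcomp r m = (\<Sum>i\<in>{0..m}. of_int (int_binom (r + i - 1) (nat i)) * hsym (m - i))"

(* Elements of Z^l are integer lists of length l, with positions numbered from 0; the superscript
   i - 1 of row i therefore becomes i. *)
definition gdet :: "int list \<Rightarrow> symf" where
  "gdet \<gamma> = det (mat (length \<gamma>) (length \<gamma>)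
                    (\<lambda>(i, j). kcomp (int i) (\<gamma> ! i + int j - int i)))"

definition pos_roots :: "nat \<Rightarrow> (nat \<times> nat) set" where
  "pos_roots l = {(i, j). i < j \<and> j < l}"

(* Exponent of the monomial  prod_((i,j) in \<Psi>) (z_i/z_j)^(n(i,j)) * prod_((i,j) in S) z_j^(-1) * z^\<gamma>. *)
definition katalan_exponent ::
  "(nat \<times> nat) set \<Rightarrow> int list \<Rightarrow> (nat \<times> nat \<Rightarrow> nat) \<Rightarrow> (nat \<times> nat) set \<Rightarrow> int list" where
  "katalan_exponent \<Psi> \<gamma> n S =
     map (\<lambda>s. \<gamma> ! s + (\<Sum>p\<in>{p \<in> \<Psi>. fst p = s}. int (n p)) - (\<Sum>p\<in>{p \<in> \<Psi>. snd p = s}. int (n p))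
              - int (card {p \<in> S. snd p = s}))
         [0..<length \<gamma>]"

(* Coefficient of z^\<alpha> in  prod_\<Psi> (1 - z_i/z_j)^(-1) * prod_L (1 - 1/z_j) * z^\<gamma>:
   every inverse factor is expanded as a geometric series in z_i/z_j (with exponent n(i,j)),
   and S is the set of factors 1 - 1/z_j contributing -1/z_j. *)
definition katalan_coeff ::
  "(nat \<times> nat) set \<Rightarrow> (nat \<times> nat) set \<Rightarrow> int list \<Rightarrow> int list \<Rightarrow> int" where
  "katalan_coeff \<Psi> L \<gamma> \<alpha> =
     (\<Sum>(n, S)\<in>{(n, S). (\<forall>p. p \<notin> \<Psi> \<longrightarrow> n p = 0) \<and> S \<subseteq> L \<and> katalan_exponent \<Psi> \<gamma> n S = \<alpha>}.
        (-1) ^ card S)"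

(* Only finitely many \<alpha> contribute: gdet \<alpha> = 0 as soon as some \<alpha>_i < i - l (i counted from 1),
   and the sum of the entries of an occurring \<alpha> is at most that of \<gamma>. *)
definition katalan ::
  "(nat \<times> nat) set \<Rightarrow> (nat \<times> nat) set \<Rightarrow> int list \<Rightarrow> symf" where
  "katalan \<Psi> L \<gamma> = Sum_any (\<lambda>\<alpha>. of_int (katalan_coeff \<Psi> L \<gamma> \<alpha>) * gdet \<alpha>)"

definition Par :: "nat \<Rightarrow> nat \<Rightarrow> int list set" where
  "Par k l = {\<mu>. length \<mu> = l \<and> sorted_wrt (\<ge>) \<mu> \<and> set \<mu> \<subseteq> {0..int k}}"

definition Delta :: "nat \<Rightarrow> int list \<Rightarrow> (nat \<times> nat) set" where
  "Delta m \<mu> = {(i, j) \<in> pos_roots (length \<mu>). int m - \<mu> ! i + int i < int j}"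

definition frak_g :: "nat \<Rightarrow> int list \<Rightarrow> symf" where
  "frak_g k \<mu> = katalan (Delta k \<mu>) (Delta (k + 1) \<mu>) \<mu>"

section \<open>The \<open>K\<close>-\<open>k\<close>-Schur functions of Lam, Schilling and Shimozono\<close>

(* Throughout n = k + 1 >= 2.  The affine symmetric group consists of the permutations w of Z with
   w(i+n) = w(i) + n and w(1) + ... + w(n) = 1 + ... + n; the simple reflections are indexed by
   residues mod n. *)
definition affine_refl :: "nat \<Rightarrow> int \<Rightarrow> int \<Rightarrow> int" where
  "affine_refl n i x = (if x mod int n = i mod int n then x + 1
                        else if x mod int n = (i + 1) mod int n then x - 1 else x)"

definition affine_perms :: "nat \<Rightarrow> (int \<Rightarrow> int) set" where
  "affine_perms n = {w. bij w \<and> (\<forall>i. w (i + int n) = w i + int n) \<and>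
                        (\<Sum>i\<in>{1..int n}. w i) = (\<Sum>i\<in>{1..int n}. i)}"

(* Minimal length representatives of the left cosets of the finite symmetric group. *)
definition affine_grassmannian :: "nat \<Rightarrow> (int \<Rightarrow> int) set" where
  "affine_grassmannian n = {w \<in> affine_perms n. strict_mono_on {1..int n} w}"

(* An element of the 0-Hecke algebra (T_i^2 = -T_i, braid relations) is given by its coefficient
   function c in the basis (T_w).  This is left multiplication by T_i, where T_i T_v = T_(s_i v) if
   s_i v > v and T_i T_v = -T_v otherwise; s_i w < w means that w^(-1)(i) > w^(-1)(i+1). *)
definition hecke_T :: "nat \<Rightarrow> int \<Rightarrow> ((int \<Rightarrow> int) \<Rightarrow> int) \<Rightarrow> (int \<Rightarrow> int) \<Rightarrow> int" where
  "hecke_T n i c w = (if inv_into UNIV w (i + 1) < inv_into UNIV w i then c (affine_refl n i \<circ> w) - c w else 0)"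

definition cyclically_decreasing :: "nat \<Rightarrow> int list \<Rightarrow> bool" where
  "cyclically_decreasing n u \<longleftrightarrow> distinct u \<and> set u \<subseteq> {0..<int n} \<and>
     (\<forall>p<length u. \<forall>q<length u. u ! p = (u ! q + 1) mod int n \<longrightarrow> p < q)"

(* Left multiplication by the sum of T_v over the cyclically decreasing elements v of length r.
   These correspond to the r-element proper subsets A of Z/nZ: the cyclically decreasing
   arrangements of A are the reduced words of one element. *)
definition hecke_k :: "nat \<Rightarrow> nat \<Rightarrow> ((int \<Rightarrow> int) \<Rightarrow> int) \<Rightarrow> (int \<Rightarrow> int) \<Rightarrow> int" where
  "hecke_k n r c w =
     (\<Sum>A\<in>{A. A \<subset> {0..<int n} \<and> card A = r}.
        foldr (hecke_T n) (SOME u. cyclically_decreasing n u \<and> set u = A) c w)"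

(* Coefficient of x_1^(a_1) ... x_t^(a_t) in the affine stable Grothendieck polynomial G_v, i.e. the
   coefficient of T_v in k_(a_t) ... k_(a_1). *)
definition affine_groth_coeff :: "nat \<Rightarrow> (int \<Rightarrow> int) \<Rightarrow> nat list \<Rightarrow> int" where
  "affine_groth_coeff n v a = fold (hecke_k n) a (\<lambda>w. if w = id then 1 else 0) v"

(* The partition whose product of h's is the given monomial, parts in increasing order. *)
definition monom_parts :: "(nat \<Rightarrow>\<^sub>0 nat) \<Rightarrow> nat list" where
  "monom_parts \<nu> = concat (map (\<lambda>i. replicate (Poly_Mapping.lookup \<nu> i) (i + 1))
                             (sorted_list_of_set (Poly_Mapping.keys \<nu>)))"

(* Hall pairing of f with the (infinite, symmetric) series G_v: the products of h's are dual to the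
   monomial symmetric functions. *)
definition pair_affine_groth :: "nat \<Rightarrow> symf \<Rightarrow> (int \<Rightarrow> int) \<Rightarrow> int" where
  "pair_affine_groth n f v =
     (\<Sum>\<nu>\<in>Poly_Mapping.keys f. Poly_Mapping.lookup f \<nu> * affine_groth_coeff n v (monom_parts \<nu>))"

(* The subring Z[h_1, ..., h_k]. *)
definition symf_bounded :: "nat \<Rightarrow> symf set" where
  "symf_bounded k = {f. \<forall>\<nu>\<in>Poly_Mapping.keys f. Poly_Mapping.keys \<nu> \<subseteq> {..<k}}"

(* The basis of Z[h_1, ..., h_k] dual to the G_v with v affine Grassmannian. *)
definition K_k_Schur_elt :: "nat \<Rightarrow> (int \<Rightarrow> int) \<Rightarrow> symf" where
  "K_k_Schur_elt k w = (THE f. f \<in> symf_bounded k \<and>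
     (\<forall>v\<in>affine_grassmannian (k + 1). pair_affine_groth (k + 1) f v = (if v = w then 1 else 0)))"

(* The affine Grassmannian element of a k-bounded partition: its reduced word lists the residues
   (column - row) mod n of the boxes, last row first and from right to left in each row. *)
definition bounded_to_grassmannian :: "nat \<Rightarrow> int list \<Rightarrow> int \<Rightarrow> int" where
  "bounded_to_grassmannian n \<mu> =
     foldr (\<lambda>i w. affine_refl n i \<circ> w)
       (concat (map (\<lambda>i. map (\<lambda>j. (int j - int i) mod int n) (rev [0..<nat (\<mu> ! i)]))
                    (rev [0..<length \<mu>])))
       id"

definition K_k_Schur :: "nat \<Rightarrow> int list \<Rightarrow> symf" where
  "K_k_Schur k \<mu> = K_k_Schur_elt k (bounded_to_grassmannian (k + 1) \<mu>)"

end

theory Submission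
  imports Defs "Jordan_Normal_Form.Char_Poly" "HOL-Computational_Algebra.Formal_Power_Series"
    "HOL-Library.Multiset"
begin

text \<open>
  The sum of \<open>u\<^sup>d e\<^sub>d\<^sup>\<bottom>\<close> over \<open>d\<close> is the ring homomorphism sending \<open>h\<^sub>m\<close> to \<open>h\<^sub>m + u h\<^bsub>m-1\<^esub>\<close>, hence it sends
  every \<open>k\<^sub>m\<^bsup>(r)\<^esup>\<close> to \<open>k\<^sub>m\<^bsup>(r)\<^esup> + u k\<^bsub>m-1\<^esub>\<^bsup>(r)\<^esup>\<close>. It turns the \<open>l \<times> l\<close> determinant \<open>g\<^bsub>\<gamma>+1\<^esub>\<close> into a
  determinant of polynomials linear in \<open>u\<close>, whose coefficient of \<open>u\<^sup>l\<close> is \<open>g\<^sub>\<gamma>\<close> and whose degree is at most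
  \<open>l\<close>. So only the first summand \<open>e\<^sub>l\<close> of \<open>G\<close> acts, and it acts by the shift \<open>g\<^bsub>\<gamma>+1\<^esub> \<mapsto> g\<^sub>\<gamma>\<close>; the root
  sets of \<open>\<lambda>\<close> at level \<open>k\<close> and of \<open>\<lambda>+1\<close> at level \<open>k+1\<close> agree.

  Since the Hall form is specified only by orthonormality of the Schur functions, the description of
  \<open>e\<^sub>d\<^sup>\<bottom>\<close> needs a form for which \<open>h\<^sub>d\<close> is adjoint to the coefficient \<open>H\<^sub>d\<close> of \<open>u\<^sup>d\<close> in \<open>h\<^sub>m \<mapsto> \<Sum>\<^sub>i u\<^sup>i h\<^bsub>m-i\<^esub>\<close>:
  the pairing of \<open>f\<close> with \<open>h\<^sub>\<beta>\<close> is the constant term of \<open>H\<^bsub>\<beta>\<^sub>1\<^esub> H\<^bsub>\<beta>\<^sub>2\<^esub> \<dots> f\<close>, which is the coefficient of \<open>x\<^sup>\<beta>\<close>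
  in \<open>f(x\<^sub>1, \<dots>, x\<^sub>N)\<close>. Orthonormality follows from the bialternant formula, uniqueness from the
  fact that the Schur functions span.
\<close>

section \<open>Evaluation homomorphisms\<close>

abbreviation "lookup \<equiv> Poly_Mapping.lookup"
abbreviation "keys \<equiv> Poly_Mapping.keys"
abbreviation "single \<equiv> Poly_Mapping.single"

lemma poly_mapping_eq_sum_single: "f = (\<Sum>v\<in>keys f. single v (lookup f v))"
  by (rule poly_mapping_eqI)
     (auto simp: lookup_sum lookup_single when_def in_keys_iff sum.delta')

lemma poly_mapping_add_induct [case_names single add]:
  assumes "\<And>v c. P (single v c)" and "\<And>f g. P f \<Longrightarrow> P g \<Longrightarrow> P (f + g)"
  shows "P (f :: 'a \<Rightarrow>\<^sub>0 'b :: comm_monoid_add)"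
proof -
  have z: "P 0" using assms(1)[of undefined 0] by simp
  have "finite A \<Longrightarrow> P (\<Sum>v\<in>A. single v (lookup f v))" for A
    by (induction A rule: finite_induct) (use z assms in auto)
  from this[of "keys f"] show ?thesis
    using poly_mapping_eq_sum_single[of f] by simp
qed

definition monom_eval :: "(nat \<Rightarrow> 'a :: comm_ring_1) \<Rightarrow> (nat \<Rightarrow>\<^sub>0 nat) \<Rightarrow> 'a" where
  "monom_eval r v = (\<Prod>i\<in>keys v. r i ^ lookup v i)"

text \<open>The homomorphism with h_(m+1) |-> \<open>r m\<close>; the index shift is that of the
  variables of \<open>symf\<close>.\<close>

definition symf_eval :: "(nat \<Rightarrow> 'a :: comm_ring_1) \<Rightarrow> symf \<Rightarrow> 'a" where
  "symf_eval r f = (\<Sum>v\<in>keys f. of_int (lookup f v) * monom_eval r v)"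

lemma monom_eval_superset:
  assumes "finite K" "keys v \<subseteq> K"
  shows "monom_eval r v = (\<Prod>i\<in>K. r i ^ lookup v i)"
  unfolding monom_eval_def using assms
  by (intro prod.mono_neutral_left) (auto simp: in_keys_iff)

lemma monom_eval_0 [simp]: "monom_eval r 0 = 1"
  by (simp add: monom_eval_def)

lemma monom_eval_single [simp]: "monom_eval r (single i n) = r i ^ n"
  by (subst monom_eval_superset[of "{i}"]) auto

lemma monom_eval_add: "monom_eval r (v + w) = monom_eval r v * monom_eval r w"
proof -
  let ?K = "keys v \<union> keys w"
  have "keys (v + w) \<subseteq> ?K" by (rule keys_add)
  then show ?thesis
    by (simp add: monom_eval_superset[of ?K] lookup_add power_add prod.distrib)
qed

lemma symf_eval_superset:
  assumes "finite K" "keys f \<subseteq> K"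
  shows "symf_eval r f = (\<Sum>v\<in>K. of_int (lookup f v) * monom_eval r v)"
  unfolding symf_eval_def using assms
  by (intro sum.mono_neutral_left) (auto simp: in_keys_iff)

lemma symf_eval_single [simp]: "symf_eval r (single v c) = of_int c * monom_eval r v"
  by (subst symf_eval_superset[of "{v}"]) auto

lemma symf_eval_0 [simp]: "symf_eval r 0 = 0"
  by (simp add: symf_eval_def)

lemma symf_eval_add: "symf_eval r (f + g) = symf_eval r f + symf_eval r g"
proof -
  let ?K = "keys f \<union> keys g"
  have "keys (f + g) \<subseteq> ?K" by (rule keys_add)
  then show ?thesis
    by (simp add: symf_eval_superset[of ?K] lookup_add algebra_simps sum.distrib)
qed

lemma symf_eval_mult: "symf_eval r (f * g) = symf_eval r f * symf_eval r g"
proof (induction f rule: poly_mapping_add_induct)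
  case (single v c)
  show ?case
    by (induction g rule: poly_mapping_add_induct)
       (auto simp: mult_single monom_eval_add symf_eval_add algebra_simps)
qed (simp add: symf_eval_add algebra_simps)

lemma symf_eval_1 [simp]: "symf_eval r 1 = 1"
  using symf_eval_single[of r 0 1] by simp

interpretation symf_eval: comm_ring_hom "symf_eval r"
  by unfold_locales (simp_all add: symf_eval_add symf_eval_mult)

lemma hsym_Suc: "hsym (int (Suc m)) = single (single m 1) 1"
  by (simp add: hsym_def nat_add_distrib)

lemma hsym_0 [simp]: "hsym 0 = 1"
  by (simp add: hsym_def)

lemma hsym_neg [simp]: "d < 0 \<Longrightarrow> hsym d = 0"
  by (simp add: hsym_def)

lemma symf_eval_hsym_Suc: "symf_eval r (hsym (int (Suc m))) = r m"
  by (simp only: hsym_Suc) simp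

definition hprod :: "nat list \<Rightarrow> symf" where
  "hprod bs = prod_list (map (\<lambda>b. hsym (int b)) bs)"

lemma hprod_simps [simp]:
  "hprod [] = 1" "hprod (b # bs) = hsym (int b) * hprod bs" "hprod (as @ bs) = hprod as * hprod bs"
  by (simp_all add: hprod_def)

lemma ex_hprod: "\<exists>bs. single v 1 = hprod bs"
proof (induction v rule: poly_mapping_add_induct)
  case (single i n)
  show ?case
  proof (induction n)
    case 0
    then show ?case by (auto intro: exI[of _ "[]"])
  next
    case (Suc n)
    then obtain bs where "single (single i n) (1::int) = hprod bs" by blast
    moreover have "single (single i (Suc n)) (1::int) = single (single i 1) 1 * single (single i n) 1"
      by (simp add: mult_single flip: single_add)
    ultimately have "single (single i (Suc n)) 1 = hprod (Suc i # bs)"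
      by (simp add: hsym_Suc del: of_nat_Suc)
    then show ?case by blast
  qed
next
  case (add v w)
  then obtain as bs where "single v (1::int) = hprod as" "single w (1::int) = hprod bs" by blast
  then have "single (v + w) 1 = hprod (as @ bs)"
    by (metis hprod_simps(3) mult_1 mult_single)
  then show ?case by blast
qed

text \<open>Monomials are products of h's by \<open>ex_hprod\<close>, and integer coefficients arise
  by repeated addition and negation. Additive claims are thus checked on \<open>hprod\<close>
  only.\<close>

lemma symf_induct [case_names hprod add uminus]:
  assumes hprod: "\<And>bs. P (hprod bs)"
    and add: "\<And>f g. P f \<Longrightarrow> P g \<Longrightarrow> P (f + g)"
    and uminus: "\<And>f. P f \<Longrightarrow> P (- f)"
  shows "P f"
proof (induction f rule: poly_mapping_add_induct)
  case (single v c)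
  have z: "P 0" using add[OF hprod[of "[]"] uminus[OF hprod[of "[]"]]] by simp
  have nat: "P (of_nat n * single v 1)" for n
  proof (induction n)
    case (Suc n)
    show ?case using add[OF _ Suc, of "single v 1"] ex_hprod[of v] hprod by (auto simp: algebra_simps)
  qed (use z in simp)
  have "single v c = of_int c * single v 1"
    by (metis add_0 mult.right_neutral mult_single of_int_eq_id single_of_int id_apply)
  moreover have "P (of_int c * single v 1)"
    using nat uminus[OF nat] by (cases c rule: int_cases2) simp_all
  ultimately show ?case by simp
qed (rule add)

lemma symf_hom_eqI:
  assumes "comm_ring_hom p" "comm_ring_hom q"
    and "\<And>m. p (hsym (int (Suc m))) = q (hsym (int (Suc m)))"
  shows "p f = q (f :: symf)"
proof -
  interpret p: comm_ring_hom p by fact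
  interpret q: comm_ring_hom q by fact
  have h: "p (hsym (int m)) = q (hsym (int m))" for m
    using assms(3) by (cases m) auto
  have "p (hprod bs) = q (hprod bs)" for bs
    by (induction bs) (simp_all add: h p.hom_mult q.hom_mult)
  then show ?thesis
    by (induction f rule: symf_induct) (simp_all add: p.hom_add q.hom_add p.hom_uminus q.hom_uminus)
qed

section \<open>The operators adjoint to multiplication by \<open>h\<^sub>d\<close> and \<open>e\<^sub>d\<close>\<close>

text \<open>With u the polynomial variable, the generating series of the h_m in t is multiplied by 1
  + u t.\<close>

definition E_hom :: "symf \<Rightarrow> symf poly" where
  "E_hom = symf_eval (\<lambda>m. [:hsym (int (Suc m)), hsym (int m):])"

text \<open>Adjoins a variable u to the alphabet: the generating series of the h_m in t is divided
  by 1 - u t.\<close>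

definition H_hom :: "symf \<Rightarrow> symf poly" where
  "H_hom = symf_eval (\<lambda>m. \<Sum>i\<le>Suc m. monom (hsym (int (Suc m) - int i)) i)"

definition E_op :: "nat \<Rightarrow> symf \<Rightarrow> symf" where
  "E_op d f = coeff (E_hom f) d"

definition H_op :: "nat \<Rightarrow> symf \<Rightarrow> symf" where
  "H_op d f = coeff (H_hom f) d"

interpretation E_hom: comm_ring_hom E_hom
  unfolding E_hom_def by unfold_locales

interpretation H_hom: comm_ring_hom H_hom
  unfolding H_hom_def by unfold_locales

lemma E_hom_hsym: "E_hom (hsym d) = [:hsym d, hsym (d - 1):]"
proof -
  consider "d < 0" | "d = 0" | m where "d = int (Suc m)"
    by (metis gr0_implies_Suc not_less_iff_gr_or_eq zero_less_imp_eq_int)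
  then show ?thesis
  proof cases
    case 2
    then show ?thesis by (simp add: one_pCons)
  next
    case (3 m)
    show ?thesis
      unfolding 3 E_hom_def symf_eval_hsym_Suc by simp
  qed simp
qed

lemma H_hom_hsym: "H_hom (hsym (int m)) = (\<Sum>i\<le>m. monom (hsym (int m - int i)) i)"
proof (cases m)
  case 0
  then show ?thesis by (simp add: one_pCons monom_0)
next
  case (Suc m)
  show ?thesis unfolding Suc H_hom_def symf_eval_hsym_Suc ..
qed

lemma H_op_hsym: "H_op n (hsym d) = hsym (d - int n)"
proof (cases "d < 0")
  case False
  then obtain m where m: "d = int m" by (metis nonneg_int_cases not_less)
  show ?thesis
    unfolding m H_op_def H_hom_hsym by (simp add: coeff_sum sum.delta')
qed (simp add: H_op_def)

lemma H_op_add: "H_op n (f + g) = H_op n f + H_op n g"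
  by (simp add: H_op_def H_hom.hom_add)

lemma H_op_uminus: "H_op n (- f) = - H_op n f"
  by (simp add: H_op_def H_hom.hom_uminus)

lemma H_op_sum: "H_op n (sum f A) = (\<Sum>x\<in>A. H_op n (f x))"
  by (simp add: H_op_def H_hom.hom_sum coeff_sum)

lemma H_op_mult: "H_op n (f * g) = (\<Sum>i\<le>n. H_op i f * H_op (n - i) g)"
  by (simp add: H_op_def H_hom.hom_mult coeff_mult)

lemma H_op_0 [simp]: "H_op 0 f = f"
proof (induction f rule: symf_induct)
  case (hprod bs)
  show ?case
    by (induction bs) (simp_all add: H_op_mult H_op_hsym, simp add: H_op_def)
qed (simp_all add: H_op_add H_op_uminus)

text \<open>Adjoining two variables is symmetric in them. On a product of h's,
  \<open>H_op_mult\<close> gives a double sum over the amounts \<open>i\<close> and \<open>j\<close>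
  taken from the first factor, where h_(m-i-j) is symmetric.\<close>

lemma H_op_commute: "H_op a (H_op b f) = H_op b (H_op a f)"
proof (induction f arbitrary: a b rule: symf_induct)
  case (hprod bs)
  show ?case
  proof (induction bs arbitrary: a b)
    case Nil
    show ?case by (simp add: H_op_def coeff_1)
  next
    case (Cons m bs)
    have exp: "H_op a (H_op b (hprod (m # bs))) =
        (\<Sum>i\<le>b. \<Sum>j\<le>a. hsym (int m - int i - int j) * H_op (a - j) (H_op (b - i) (hprod bs)))" for a b
      by (simp add: H_op_mult H_op_sum H_op_hsym)
    show ?case
      unfolding exp by (subst sum.swap, intro sum.cong refl) (simp add: Cons.IH algebra_simps)
  qed
qed (simp_all add: H_op_add H_op_uminus)

definition H_ops :: "nat list \<Rightarrow> symf \<Rightarrow> symf" where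
  "H_ops bs f = foldr H_op bs f"

lemma H_ops_simps [simp]:
  "H_ops [] f = f" "H_ops (b # bs) f = H_op b (H_ops bs f)"
  "H_ops (as @ bs) f = H_ops as (H_ops bs f)"
  by (simp_all add: H_ops_def)

lemma H_ops_add: "H_ops bs (f + g) = H_ops bs f + H_ops bs g"
  by (induction bs) (simp_all add: H_op_add)

lemma H_ops_mset_cong: "mset as = mset bs \<Longrightarrow> H_ops as f = H_ops bs f"
  unfolding H_ops_def foldr_conv_fold
  by (subst fold_multiset_equiv[of "rev as" H_op "rev bs"]) (auto simp: H_op_commute)

lemma H_ops_filter: "H_ops (filter (\<lambda>b. b \<noteq> 0) bs) f = H_ops bs f"
  by (induction bs) simp_all

definition hexp :: "nat list \<Rightarrow> nat \<Rightarrow>\<^sub>0 nat" where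
  "hexp bs = (\<Sum>b\<leftarrow>bs. if b = 0 then 0 else single (b - 1) 1)"

lemma hprod_eq_single: "hprod bs = single (hexp bs) 1"
proof (induction bs)
  case (Cons b bs)
  have "hsym (int b) = single (if b = 0 then 0 else single (b - 1) 1) 1"
    by (cases b) (simp_all add: hsym_Suc del: of_nat_Suc)
  then show ?case using Cons by (simp add: mult_single hexp_def)
qed (simp add: hexp_def)

lemma lookup_hexp: "lookup (hexp bs) i = count (mset bs) (Suc i)"
  by (induction bs) (auto simp: hexp_def lookup_add lookup_single when_def)

text \<open>Lists with the same product of h's differ only by order and by zeros; the operators
  commute and \<open>H_op 0\<close> is the identity.\<close>

lemma H_ops_cong:
  assumes "hprod as = hprod bs"
  shows "H_ops as f = H_ops bs f"
proof -
  \<comment> \<open>The only key of a monomial with coefficient 1 is its exponent vector.\<close>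
  have "hexp as = hexp bs"
    using assms unfolding hprod_eq_single by (metis keys_frag_of singleton_inject)
  then have cnt: "count (mset as) (Suc i) = count (mset bs) (Suc i)" for i
    by (metis lookup_hexp)
  have "mset (filter (\<lambda>b. b \<noteq> 0) as) = mset (filter (\<lambda>b. b \<noteq> 0) bs)"
  proof (intro multiset_eqI)
    fix x
    show "count (mset (filter (\<lambda>b. b \<noteq> 0) as)) x = count (mset (filter (\<lambda>b. b \<noteq> 0) bs)) x"
      using cnt by (cases x) simp_all
  qed
  then show ?thesis
    by (metis H_ops_mset_cong H_ops_filter)
qed

section \<open>The candidate for the Hall form\<close>

definition const_term :: "symf \<Rightarrow> int" where
  "const_term = symf_eval (\<lambda>_. 0)"

interpretation const_term: comm_ring_hom const_term
  unfolding const_term_def by unfold_locales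

text \<open>Extended linearly in \<open>c\<close> from the basis of monomials in the h's; by
  \<open>H_ops_cong\<close> the list picked by \<open>SOME\<close> is immaterial.\<close>

definition hall_form :: "symf \<Rightarrow> symf \<Rightarrow> int" where
  "hall_form f c = (\<Sum>v\<in>keys c. lookup c v * const_term (H_ops (SOME bs. hprod bs = single v 1) f))"

lemma hall_form_superset:
  assumes "finite K" "keys c \<subseteq> K"
  shows "hall_form f c =
    (\<Sum>v\<in>K. lookup c v * const_term (H_ops (SOME bs. hprod bs = single v 1) f))"
  unfolding hall_form_def using assms
  by (intro sum.mono_neutral_left) (auto simp: in_keys_iff)

lemma hall_form_add_right: "hall_form f (c + d) = hall_form f c + hall_form f d"
proof -
  let ?K = "keys c \<union> keys d"
  have "keys (c + d) \<subseteq> ?K" by (rule keys_add)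
  then show ?thesis
    by (simp add: hall_form_superset[of ?K] lookup_add algebra_simps sum.distrib)
qed

lemma hall_form_add_left: "hall_form (f + g) c = hall_form f c + hall_form g c"
  by (simp add: hall_form_def H_ops_add const_term.hom_add algebra_simps sum.distrib)

lemma hall_form_hprod: "hall_form f (hprod bs) = const_term (H_ops bs f)"
proof -
  let ?bs = "SOME as. hprod as = hprod bs"
  have "hprod ?bs = hprod bs" by (rule someI[of _ bs]) simp
  then have "H_ops ?bs f = H_ops bs f" by (rule H_ops_cong)
  then show ?thesis
    unfolding hall_form_def by (simp add: hprod_eq_single)
qed

lemma additive_uminus_sum:
  fixes B :: "'a :: ab_group_add \<Rightarrow> 'b :: ab_group_add"
  assumes "\<And>x y. B (x + y) = B x + B y"
  shows "B 0 = 0" "B (- x) = - B x" "B (sum g A) = (\<Sum>i\<in>A. B (g i))"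
proof -
  interpret additive B by (rule additive.intro) (rule assms)
  show "B 0 = 0" "B (- x) = - B x" "B (sum g A) = (\<Sum>i\<in>A. B (g i))"
    by (rule zero minus sum)+
qed

lemma hall_form_hsym_mult: "hall_form f (hsym (int d) * c) = hall_form (H_op d f) c"
proof (induction c rule: symf_induct)
  case (hprod bs)
  \<comment> \<open>\<open>H_ops\<close> applies the last entry first, so appending \<open>d\<close>
    lets \<open>H_op d\<close> act directly on \<open>f\<close>.\<close>
  have "hall_form f (hprod (bs @ [d])) = hall_form (H_op d f) (hprod bs)"
    unfolding hall_form_hprod by simp
  then show ?case by (simp add: mult.commute)
next
  case (add c d)
  then show ?case by (simp add: algebra_simps hall_form_add_right)
next
  case (uminus c)
  then show ?case
    using additive_uminus_sum(2)[of "hall_form f" "hsym (int d) * c", OF hall_form_add_right]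
      additive_uminus_sum(2)[of "hall_form (H_op d f)" c, OF hall_form_add_right] by simp
qed

text \<open>With v the variable of \<open>H_hom\<close>, the factors 1 + u t and 1/(1 - v t) cancel
  after substituting v = -u. On a single h_n this is a telescoping sum.\<close>

lemma E_hom_H_hom:
  "poly (map_poly E_hom (H_hom f)) [:0, -1:] = [:f:]"
proof (rule symf_hom_eqI[of "\<lambda>f. poly (map_poly E_hom (H_hom f)) [:0, -1:]" "\<lambda>f. [:f:]"])
  interpret m: map_poly_comm_ring_hom E_hom ..
  show "comm_ring_hom (\<lambda>f. poly (map_poly E_hom (H_hom f)) [:0, -1:])"
    by unfold_locales (simp_all add: H_hom.hom_add H_hom.hom_mult m.hom_add m.hom_mult)
  show "comm_ring_hom (\<lambda>f::symf. [:f:])"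
    by unfold_locales (simp_all add: one_pCons)
  fix n
  let ?n = "int (Suc n)"
  \<comment> \<open>The remainder term disappears at \<open>j = Suc n\<close>, where its factor is
    h_(-1) = 0.\<close>
  have tele: "(\<Sum>i\<le>j. [:hsym (?n - int i), hsym (?n - int i - 1):] * [:0, -1:] ^ i)
      = [:hsym ?n:] - [:0, -1:] ^ Suc j * [:hsym (?n - int j - 1):]" for j
  proof (induction j)
    case 0
    show ?case by simp
  next
    case (Suc j)
    \<comment> \<open>Writes u as -(-u), so that the new term splits into one that cancels the old
      remainder and one that is the next remainder.\<close>
    have *: "[:a, b:] * p = [:a:] * p - [:b:] * ([:0, -1:] * p)" for a b :: symf and p
    proof -
      have "[:a, b:] * p = ([:a:] - [:b:] * [:0, -1:]) * p" by simp
      then show ?thesis by (simp only: left_diff_distrib mult.assoc)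
    qed
    have n: "?n - int (Suc j) = ?n - int j - 1" by simp
    have **: "h - p * b + (b * p - c * (q * p)) = h - q * p * c" for h p b c q :: "symf poly"
      by (simp add: algebra_simps)
    show ?case
      unfolding sum.atMost_Suc Suc n power_Suc[of _ "Suc j"]
      by (subst *[of "hsym (?n - int j - 1)" "hsym (?n - int j - 1 - 1)"]) (rule **)
  qed
  have "poly (map_poly E_hom (H_hom (hsym ?n))) [:0, -1:] =
      (\<Sum>i\<le>Suc n. E_hom (hsym (?n - int i)) * [:0, -1:] ^ i)"
    unfolding H_hom_hsym
    by (simp only: m.hom_sum poly_sum map_poly_monom E_hom.hom_zero poly_monom)
  also have "\<dots> = [:hsym ?n:]"
    unfolding E_hom_hsym tele by simp
  finally show "poly (map_poly E_hom (H_hom (hsym ?n))) [:0, -1:] = [:hsym ?n:]" .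
qed

lemma coeff_mult_neg_X_power:
  "coeff (q * [:0, -1:] ^ i) d = (if i \<le> d then (-1) ^ i * coeff q (d - i) else (0 :: 'a :: comm_ring_1))"
proof (induction i arbitrary: d)
  case (Suc i)
  have "q * [:0, -1:] ^ Suc i = pCons 0 (- (q * [:0, -1:] ^ i))"
    by (simp add: algebra_simps)
  then show ?case using Suc by (cases d) (auto simp: coeff_pCons)
qed simp

lemma poly_altdef_le:
  fixes p :: "'a :: comm_ring_1 poly"
  assumes "degree p \<le> n"
  shows "poly p x = (\<Sum>i\<le>n. coeff p i * x ^ i)"
  unfolding poly_altdef using assms
  by (intro sum.mono_neutral_left) (auto simp: coeff_eq_0)

text \<open>The coefficient of u^d in \<open>E_hom_H_hom\<close>: the operator form of the relation
  between the h's and the e's.\<close>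

lemma E_op_H_op: "(\<Sum>i\<le>d. (-1) ^ i * E_op (d - i) (H_op i f)) = coeff [:f:] d"
proof -
  let ?p = "map_poly E_hom (H_hom f)"
  \<comment> \<open>A bound above both the degree and \<open>d\<close>: the expansion up to
    \<open>n\<close> is complete, and cutting it at \<open>d\<close> loses nothing in the
    coefficient of u^d.\<close>
  define n where "n = degree ?p + d"
  have c: "coeff ?p i = E_hom (H_op i f)" for i
    by (simp add: coeff_map_poly H_op_def)
  have "poly ?p [:0, -1:] = (\<Sum>i\<le>n. coeff ?p i * [:0, -1:] ^ i)"
    by (rule poly_altdef_le) (simp add: n_def)
  then have "coeff [:f:] d = (\<Sum>i\<le>n. coeff (E_hom (H_op i f) * [:0, -1:] ^ i) d)"
    unfolding E_hom_H_hom c by (simp add: coeff_sum)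
  also have "\<dots> = (\<Sum>i\<le>d. coeff (E_hom (H_op i f) * [:0, -1:] ^ i) d)"
    by (rule sum.mono_neutral_right) (auto simp: n_def coeff_mult_neg_X_power)
  also have "\<dots> = (\<Sum>i\<le>d. (-1) ^ i * E_op (d - i) (H_op i f))"
    by (intro sum.cong refl) (simp add: coeff_mult_neg_X_power E_op_def)
  finally show ?thesis by simp
qed

lemma E_op_0 [simp]: "E_op 0 f = f"
  using E_op_H_op[of 0 f] by simp

text \<open>Isolating the term \<open>i = 0\<close> of \<open>E_op_H_op\<close> gives the very
  recursion that defines \<open>esym\<close>.\<close>

lemma E_op_Suc: "E_op (Suc d) f = (\<Sum>i\<le>d. (-1) ^ i * E_op (d - i) (H_op (Suc i) f))"
  using E_op_H_op[of "Suc d" f]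
  by (simp add: sum.atMost_Suc_shift sum_negf add_eq_0_iff2 del: sum.atMost_Suc)

text \<open>\<open>esym\<close> and \<open>E_op\<close> obey parallel recursions, and
  \<open>hall_form_hsym_mult\<close> matches them term by term.\<close>

lemma hall_form_esym_mult: "hall_form f (esym d * c) = hall_form (E_op d f) c"
proof (induction d arbitrary: f c rule: less_induct)
  case (less d)
  show ?case
  proof (cases d)
    case (Suc d)
    note R = additive_uminus_sum[of "hall_form g" for g, OF hall_form_add_right]
    note L = additive_uminus_sum[of "\<lambda>f. hall_form f g" for g, OF hall_form_add_left]
    have sgnR: "hall_form g ((-1) ^ i * x) = (-1) ^ i * hall_form g x" for g i x
      by (cases "even i") (simp_all add: R)
    have sgnL: "hall_form ((-1) ^ i * x) g = (-1) ^ i * hall_form x g" for g i x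
      by (cases "even i") (simp_all add: L)
    have "hall_form f (esym (Suc d) * c) =
        (\<Sum>i\<le>d. (-1) ^ i * hall_form f (hsym (int (Suc i)) * (esym (d - i) * c)))"
      by (simp add: sum_distrib_right R(3) sgnR mult.assoc atLeast0AtMost add.commute)
    also have "\<dots> = (\<Sum>i\<le>d. (-1) ^ i * hall_form (E_op (d - i) (H_op (Suc i) f)) c)"
      using less.IH[of "d - i" for i] Suc by (intro sum.cong refl) (simp add: hall_form_hsym_mult del: of_nat_Suc)
    also have "\<dots> = hall_form (E_op (Suc d) f) c"
      unfolding E_op_Suc by (simp add: L(3) sgnL)
    finally show ?thesis using Suc by simp
  qed simp
qed

section \<open>Specialisation to finitely many variables\<close>

text \<open>From here on \<open>symf\<close> also serves as Z[x_0, x_1, ...]: index \<open>i\<close>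
  means h_(i+1) in arguments of \<open>theta\<close>, but x_i in its values.\<close>

definition xvar :: "nat \<Rightarrow> symf" where
  "xvar i = single (single i 1) 1"

text \<open>The series 1/(1 - a t), as \<open>geo_fps_inverse\<close> confirms.\<close>

definition geo_fps :: "'a :: comm_ring_1 \<Rightarrow> 'a fps" where
  "geo_fps a = Abs_fps (\<lambda>n. a ^ n)"

lemma geo_fps_nth [simp]: "fps_nth (geo_fps a) n = a ^ n"
  by (simp add: geo_fps_def)

lemma geo_fps_inverse: "(1 - fps_const a * fps_X) * geo_fps a = 1"
proof (rule fps_ext)
  fix n
  show "fps_nth ((1 - fps_const a * fps_X) * geo_fps a) n = fps_nth 1 n"
    by (cases n) (simp_all add: left_diff_distrib mult.assoc)
qed

text \<open>The complete homogeneous polynomial h_m(x_0, ..., x_(N-1)).\<close>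

definition h_poly :: "nat \<Rightarrow> nat \<Rightarrow> symf" where
  "h_poly N m = fps_nth (\<Prod>i<N. geo_fps (xvar i)) m"

lemma h_poly_0_right [simp]: "h_poly N 0 = 1"
  by (induction N) (simp_all add: h_poly_def fps_mult_nth)

lemma h_poly_0_left: "h_poly 0 (Suc m) = 0"
  by (simp add: h_poly_def)

lemma h_poly_Suc: "h_poly (Suc N) m = (\<Sum>i\<le>m. h_poly N (m - i) * xvar N ^ i)"
  unfolding h_poly_def prod.lessThan_Suc
  by (subst mult.commute) (simp add: fps_mult_nth atLeast0AtMost mult.commute)

definition theta :: "nat \<Rightarrow> symf \<Rightarrow> symf" where
  "theta N = symf_eval (\<lambda>m. h_poly N (Suc m))"

interpretation theta: comm_ring_hom "theta N"
  unfolding theta_def by unfold_locales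

lemma theta_hsym: "theta N (hsym (int m)) = h_poly N m"
  by (cases m) (simp_all add: theta_def symf_eval_hsym_Suc del: of_nat_Suc)

text \<open>Adjoining x_N to the first N variables is \<open>H_hom\<close> followed by the
  substitution u = x_N.\<close>

lemma theta_Suc:
  "theta (Suc N) f = (\<Sum>i\<le>degree (H_hom f). theta N (H_op i f) * xvar N ^ i)"
proof -
  interpret m: map_poly_comm_ring_hom "theta N" ..
  have "theta (Suc N) f = poly (map_poly (theta N) (H_hom f)) (xvar N)"
  proof (rule symf_hom_eqI[of _ "\<lambda>f. poly (map_poly (theta N) (H_hom f)) (xvar N)"])
    show "comm_ring_hom (theta (Suc N))" by unfold_locales
    show "comm_ring_hom (\<lambda>f. poly (map_poly (theta N) (H_hom f)) (xvar N))"
      by unfold_locales (simp_all add: H_hom.hom_add H_hom.hom_mult m.hom_add m.hom_mult)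
    fix n
    show "theta (Suc N) (hsym (int (Suc n))) =
        poly (map_poly (theta N) (H_hom (hsym (int (Suc n))))) (xvar N)"
      unfolding H_hom_hsym theta_hsym h_poly_Suc
      by (simp only: m.hom_sum poly_sum map_poly_monom theta.hom_zero poly_monom)
         (intro sum.cong refl, metis atMost_iff of_nat_diff theta_hsym)
  qed
  also have "\<dots> = (\<Sum>i\<le>degree (H_hom f). coeff (map_poly (theta N) (H_hom f)) i * xvar N ^ i)"
    by (rule poly_altdef_le) (rule map_poly_degree_leq)
  finally show ?thesis by (simp add: H_op_def)
qed

definition vars_below :: "nat \<Rightarrow> symf \<Rightarrow> bool" where
  "vars_below N g \<longleftrightarrow> (\<forall>v\<in>keys g. \<forall>i\<ge>N. lookup v i = 0)"

lemma vars_below_intros: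
  "vars_below N 0" "vars_below N 1"
  "vars_below N f \<Longrightarrow> vars_below N g \<Longrightarrow> vars_below N (f + g)"
  "vars_below N f \<Longrightarrow> vars_below N g \<Longrightarrow> vars_below N (f * g)"
  "vars_below N f \<Longrightarrow> vars_below N (- f)"
  "i < N \<Longrightarrow> vars_below N (xvar i)"
  "vars_below N f \<Longrightarrow> vars_below (Suc N) f"
proof -
  show "vars_below N f \<Longrightarrow> vars_below N g \<Longrightarrow> vars_below N (f + g)"
    using keys_add[of f g] by (auto simp: vars_below_def)
  show "vars_below N f \<Longrightarrow> vars_below N g \<Longrightarrow> vars_below N (f * g)"
    using keys_mult[of f g] by (fastforce simp: vars_below_def lookup_add)
qed (auto simp: vars_below_def xvar_def lookup_single when_def)

lemma vars_below_power: "vars_below N f \<Longrightarrow> vars_below N (f ^ n)"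
  by (induction n) (simp_all add: vars_below_intros)

lemma vars_below_sum: "(\<And>x. x \<in> A \<Longrightarrow> vars_below N (f x)) \<Longrightarrow> vars_below N (sum f A)"
  by (induction A rule: infinite_finite_induct) (simp_all add: vars_below_intros)

lemma vars_below_h_poly: "vars_below N (h_poly N m)"
proof (induction N arbitrary: m)
  case 0
  show ?case by (cases m) (simp_all add: h_poly_0_left vars_below_intros)
next
  case (Suc N)
  have "vars_below (Suc N) (xvar N)" by (simp add: vars_below_intros)
  then show ?case unfolding h_poly_Suc
    by (intro vars_below_sum vars_below_intros(4)[OF vars_below_intros(7)[OF Suc]] vars_below_power)
qed

lemma vars_below_theta: "vars_below N (theta N f)"
proof (induction f rule: symf_induct)
  case (hprod bs)
  show ?case
    by (induction bs) (simp_all add: vars_below_intros theta.hom_mult theta_hsym vars_below_h_poly)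
qed (simp_all add: vars_below_intros theta.hom_add theta.hom_uminus)

lemma lookup_mult_single_add:
  fixes g :: symf
  shows "lookup (g * single w c) (u + w) = lookup g u * c"
  by (induction g rule: poly_mapping_add_induct)
     (auto simp: mult_single lookup_single when_def lookup_add algebra_simps)

lemma lookup_mult_single_eq_0:
  fixes g :: symf
  assumes "\<And>u. u \<in> keys g \<Longrightarrow> v \<noteq> u + w"
  shows "lookup (g * single w c) v = 0"
proof (rule ccontr)
  assume "lookup (g * single w c) v \<noteq> 0"
  then have "v \<in> keys (g * single w c)" by (simp add: in_keys_iff)
  then obtain u w' where "u \<in> keys g" "w' \<in> keys (single w c)" "v = u + w'"
    using keys_mult[of g "single w c"] by blast
  then show False using assms by (auto split: if_splits)
qed

abbreviation "pm_nth \<equiv> Poly_Mapping.nth"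

lemma lookup_pm_nth: "lookup (pm_nth bs) i = (if i < length bs then bs ! i else 0)"
  by (simp add: nth_default_def)

lemma pm_nth_append: "pm_nth (bs @ [d]) = pm_nth bs + single (length bs) d"
  by (rule poly_mapping_eqI)
     (auto simp: lookup_pm_nth lookup_add lookup_single when_def nth_append simp del: Poly_Mapping.lookup_nth)

lemma xvar_power: "xvar i ^ n = single (single i n) 1"
  by (induction n) (simp_all add: xvar_def mult_single flip: single_add)

text \<open>The coefficients in \<open>theta_Suc\<close> do not contain x_N, so only the summand
  \<open>i = d\<close> contributes to x_N^d.\<close>

lemma lookup_theta_Suc:
  assumes "length bs = N"
  shows "lookup (theta (Suc N) f) (pm_nth (bs @ [d])) = lookup (theta N (H_op d f)) (pm_nth bs)"
proof -
  let ?v = "pm_nth bs + single N d"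
  have v: "lookup ?v N = d"
    using assms by (simp add: lookup_add lookup_pm_nth del: Poly_Mapping.lookup_nth)
  have other: "lookup (theta N (H_op i f) * xvar N ^ i) ?v = 0" if "i \<noteq> d" for i
    unfolding xvar_power
  proof (rule lookup_mult_single_eq_0)
    fix u assume "u \<in> keys (theta N (H_op i f))"
    then have "lookup u N = 0" using vars_below_theta by (auto simp: vars_below_def)
    then show "?v \<noteq> u + single N i" using that v by (metis add_0 lookup_add lookup_single_eq)
  qed
  have "lookup (theta (Suc N) f) ?v = (\<Sum>i\<le>degree (H_hom f). lookup (theta N (H_op i f) * xvar N ^ i) ?v)"
    unfolding theta_Suc lookup_sum ..
  \<comment> \<open>Here \<open>d\<close> may exceed the degree of \<open>H_hom f\<close>; then
    \<open>H_op d f\<close> is 0.\<close>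
  also have "\<dots> = (\<Sum>i\<in>{d}. lookup (theta N (H_op i f) * xvar N ^ i) ?v)"
  proof (rule sum.mono_neutral_cong)
    show "lookup (theta N (H_op i f) * xvar N ^ i) ?v = 0" if "i \<in> {d} - {..degree (H_hom f)}" for i
      using that by (simp add: H_op_def coeff_eq_0)
  qed (use other in auto)
  also have "\<dots> = lookup (theta N (H_op d f)) (pm_nth bs)"
    using lookup_mult_single_add[of "theta N (H_op d f)" "single N d" 1 "pm_nth bs"]
    by (simp add: xvar_power)
  finally show ?thesis unfolding pm_nth_append using assms by simp
qed

lemma theta_0: "theta 0 f = of_int (const_term f)"
proof (rule symf_hom_eqI[of _ "\<lambda>f. of_int (const_term f)"])
  show "comm_ring_hom (\<lambda>f. of_int (const_term f) :: symf)"
    by unfold_locales (simp_all add: const_term.hom_add const_term.hom_mult)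
  show "theta 0 (hsym (int (Suc m))) = of_int (const_term (hsym (int (Suc m))))" for m
    unfolding theta_hsym h_poly_0_left const_term_def symf_eval_hsym_Suc by simp
qed unfold_locales

text \<open>Peels off the last variable repeatedly; with no variables left, all h_m with m >= 1
  vanish and the constant term remains.\<close>

lemma lookup_theta: "lookup (theta (length bs) f) (pm_nth bs) = const_term (H_ops bs f)"
proof (induction bs arbitrary: f rule: rev_induct)
  case Nil
  have "pm_nth [] = (0 :: nat \<Rightarrow>\<^sub>0 nat)" by simp
  then show ?case by (simp add: theta_0 lookup_of_int)
next
  case (snoc d bs)
  then show ?case by (simp add: lookup_theta_Suc)
qed

section \<open>Orthonormality of the Schur functions\<close>

lemma det_mat:
  "det (mat n n f) = (\<Sum>p | p permutes {0..<n}. signof p * (\<Prod>i = 0..<n. f (i, p i)))"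
  by (subst det_def'[of _ n])
     (auto intro!: sum.cong prod.cong arg_cong2[where f = "(*)"] simp: permutes_in_image)

lemma prod_hsym_eq:
  fixes e :: "nat \<Rightarrow> int"
  shows "(\<Prod>i = 0..<n. hsym (e i)) =
    (if \<forall>i<n. 0 \<le> e i then hprod (map (\<lambda>i. nat (e i)) [0..<n]) else 0)"
proof (cases "\<forall>i<n. 0 \<le> e i")
  case True
  then have "(\<Prod>i = 0..<n. hsym (e i)) = hprod (map (\<lambda>i. nat (e i)) [0..<n])"
    by (induction n) (simp_all add: mult.commute)
  then show ?thesis using True by simp
next
  case False
  then have "\<exists>i\<in>{0..<n}. hsym (e i) = 0" by (metis atLeastLessThan_iff hsym_neg not_le zero_le)
  then have "(\<Prod>i = 0..<n. hsym (e i)) = 0" by (intro prod_zero) auto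
  then show ?thesis unfolding if_not_P[OF False] .
qed

lemma schur_expand:
  "schur q = (\<Sum>p | p permutes {0..<length q}. signof p *
     (\<Prod>i = 0..<length q. hsym (int (q ! i) + int (p i) - int i)))"
  by (simp add: schur_def det_mat)

text \<open>The bialternant numerator, with one row per variable; for \<alpha> = 0 it is the
  Vandermonde determinant.\<close>

definition alternant :: "nat list \<Rightarrow> symf" where
  "alternant \<alpha> = det (mat (length \<alpha>) (length \<alpha>)
     (\<lambda>(j, i). xvar j ^ (\<alpha> ! i + (length \<alpha> - 1 - i))))"

text \<open>The product is a polynomial of degree at most \<open>card S\<close>.\<close>

lemma prod_linear_fps_nth_eq_0:
  assumes "finite S" "card S < n"
  shows "fps_nth (\<Prod>i\<in>S. 1 - fps_const (a i) * fps_X) n = (0 :: 'a :: comm_ring_1)"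
  using assms
proof (induction S arbitrary: n rule: finite_induct)
  case (insert i S)
  then obtain m where "n = Suc m" "card S < m" by (cases n) auto
  with insert show ?case by (simp add: left_diff_distrib mult.assoc)
qed simp

text \<open>Multiplying the generating function of the complete symmetric polynomials by the linear factors
  other than the \<open>j\<close>-th leaves the geometric series of \<open>x\<^sub>j\<close>.\<close>

lemma xvar_power_eq_sum:
  assumes "j < N" and a: "0 \<le> a + int N - 1"
  shows "(\<Sum>k<N. fps_nth (\<Prod>i\<in>{..<N} - {j}. 1 - fps_const (xvar i) * fps_X) (N - Suc k) *
            theta N (hsym (a + int k))) = xvar j ^ nat (a + int N - 1)"
proof -
  let ?P = "\<Prod>i\<in>{..<N} - {j}. 1 - fps_const (xvar i) * fps_X"
  define n where "n = nat (a + int N - 1)"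
  have n: "int n = a + int N - 1" using a by (simp add: n_def)
  have "(\<Prod>i<N. geo_fps (xvar i)) = geo_fps (xvar j) * (\<Prod>i\<in>{..<N} - {j}. geo_fps (xvar i))"
    using assms by (intro prod.remove) auto
  then have "?P * (\<Prod>i<N. geo_fps (xvar i)) = geo_fps (xvar j) *
      (\<Prod>i\<in>{..<N} - {j}. (1 - fps_const (xvar i) * fps_X) * geo_fps (xvar i))"
    by (simp only: prod.distrib ac_simps)
  then have "?P * (\<Prod>i<N. geo_fps (xvar i)) = geo_fps (xvar j)"
    by (simp add: geo_fps_inverse)
  then have "xvar j ^ n = fps_nth (?P * (\<Prod>i<N. geo_fps (xvar i))) n" by simp
  also have "\<dots> = (\<Sum>r = 0..n. fps_nth ?P r * theta N (hsym (int n - int r)))"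
    unfolding fps_mult_nth
    by (intro sum.cong refl) (simp flip: of_nat_diff add: theta_hsym h_poly_def)
  \<comment> \<open>Terms with \<open>r \<ge> N\<close> vanish because only N - 1 linear factors are
    present, terms with \<open>r > n\<close> because the index of h is negative.\<close>
  also have "\<dots> = (\<Sum>r<N. fps_nth ?P r * theta N (hsym (int n - int r)))"
  proof (rule sum.mono_neutral_cong)
    fix r assume "r \<in> {0..n} - {..<N}"
    then show "fps_nth ?P r * theta N (hsym (int n - int r)) = 0"
      using assms(1) by (subst prod_linear_fps_nth_eq_0) auto
  qed auto
  also have "\<dots> = (\<Sum>k<N. fps_nth ?P (N - Suc k) * theta N (hsym (int n - int (N - Suc k))))"
    by (rule sum.nat_diff_reindex[symmetric])
  also have "\<dots> = (\<Sum>k<N. fps_nth ?P (N - Suc k) * theta N (hsym (a + int k)))"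
    by (intro sum.cong refl) (simp add: n algebra_simps of_nat_diff)
  finally show ?thesis by (simp add: n_def)
qed

text \<open>The matrix is upper unitriangular: h has negative index below the diagonal and index 0
  on it.\<close>

lemma schur_replicate_0: "schur (replicate N 0) = 1"
proof -
  let ?A = "mat N N (\<lambda>(i, j). hsym (int j - int i))"
  have "det ?A = prod_list (diag_mat ?A)"
    by (rule det_upper_triangular[of _ N]) (auto intro!: upper_triangularI)
  also have "diag_mat ?A = replicate N 1"
    by (rule nth_equalityI) (simp_all add: diag_mat_def)
  finally have "det ?A = 1" by simp
  moreover have "schur (replicate N 0) = det ?A"
    unfolding schur_def by (rule arg_cong[where f = det]) (auto intro!: eq_matI)
  ultimately show ?thesis by simp
qed

text \<open>By \<open>xvar_power_eq_sum\<close> the matrix of the alternant is \<open>M\<close>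
  times the transposed Jacobi-Trudi matrix. \<open>M\<close> does not depend on \<alpha>, so the
  case \<alpha> = 0 identifies its determinant without evaluating it.\<close>

lemma alternant_eq_theta_schur:
  assumes [simp]: "length \<alpha> = N"
  shows "alternant \<alpha> = alternant (replicate N 0) * theta N (schur \<alpha>)"
proof -
  define M where "M = mat N N (\<lambda>(j, k).
    fps_nth (\<Prod>i\<in>{..<N} - {j}. 1 - fps_const (xvar i) * fps_X) (N - Suc k))"
  have main: "alternant \<beta> = det M * theta N (schur \<beta>)" if \<beta>: "length \<beta> = N" for \<beta>
  proof -
    let ?H = "mat N N (\<lambda>(k, i). theta N (hsym (int (\<beta> ! i) + int k - int i)))"
    let ?S = "mat N N (\<lambda>(i, k). hsym (int (\<beta> ! i) + int k - int i))"
    let ?X = "mat N N (\<lambda>(j, i). xvar j ^ (\<beta> ! i + (N - 1 - i)))"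
    have "?X = M * ?H"
    proof (rule eq_matI)
      fix j i assume "j < dim_row (M * ?H)" "i < dim_col (M * ?H)"
      then have ji: "j < N" "i < N" by (simp_all add: M_def)
      have "(M * ?H) $$ (j, i) = (\<Sum>k<N. fps_nth (\<Prod>i\<in>{..<N} - {j}. 1 - fps_const (xvar i) * fps_X) (N - Suc k) *
            theta N (hsym ((int (\<beta> ! i) - int i) + int k)))"
        using ji by (simp add: M_def scalar_prod_def lessThan_atLeast0 algebra_simps)
      also have "\<dots> = xvar j ^ nat ((int (\<beta> ! i) - int i) + int N - 1)"
        by (rule xvar_power_eq_sum) (use ji in auto)
      also have "nat ((int (\<beta> ! i) - int i) + int N - 1) = \<beta> ! i + (N - 1 - i)"
        using ji by linarith
      finally show "?X $$ (j, i) = (M * ?H) $$ (j, i)" using ji by simp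
    qed (simp_all add: M_def)
    then have "det ?X = det M * det ?H"
      by (simp add: det_mult[of _ N] M_def)
    also have "?H = transpose_mat (map_mat (theta N) ?S)"
      by (rule eq_matI) auto
    also have "det \<dots> = theta N (det ?S)"
      by (subst det_transpose[of _ N]) simp_all
    finally show ?thesis unfolding alternant_def schur_def \<beta> .
  qed
  from main[of "replicate N 0"] have "alternant (replicate N 0) = det M"
    by (simp add: schur_replicate_0)
  then show ?thesis using main[of \<alpha>] by simp
qed

section \<open>Pairings with Schur functions as coefficients\<close>

lemma prod_xvar_power: "(\<Prod>j = 0..<N. xvar j ^ e j) = single (pm_nth (map e [0..<N])) 1"
  by (induction N) (simp_all add: pm_nth_append xvar_power mult_single)

lemma alternant_expand:
  "alternant \<alpha> = (\<Sum>p | p permutes {0..<length \<alpha>}. signof p *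
     single (pm_nth (map (\<lambda>j. \<alpha> ! p j + (length \<alpha> - 1 - p j)) [0..<length \<alpha>])) 1)"
  by (simp add: alternant_def det_mat prod_xvar_power)

lemma lookup_signof_mult: "lookup (signof p * f) v = signof p * lookup (f :: symf) v"
  by (simp add: sign_def)

lemma hall_form_signof_mult: "hall_form f (signof p * c) = signof p * hall_form f c"
  by (simp add: sign_def additive_uminus_sum[of "hall_form f", OF hall_form_add_right])

lemma pm_nth_add:
  assumes "length as = length bs"
  shows "pm_nth as + pm_nth bs = pm_nth (map2 (+) as bs)"
  using assms
  by (intro poly_mapping_eqI) (simp add: lookup_add lookup_pm_nth del: Poly_Mapping.lookup_nth)

text \<open>Both sides are the same signed sum over permutations of coefficients of \<open>theta N f\<close>.\<close>

lemma hall_form_schur: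
  fixes \<mu> :: "nat list"
  defines "N \<equiv> length \<mu>"
  shows "hall_form f (schur \<mu>) =
    lookup (theta N f * alternant (replicate N 0)) (pm_nth (map (\<lambda>j. \<mu> ! j + (N - 1 - j)) [0..<N]))"
proof -
  let ?g = "map (\<lambda>j. \<mu> ! j + (N - 1 - j)) [0..<N]"
  let ?w = "\<lambda>p. map (\<lambda>j. N - 1 - p j) [0..<N]"
  have summand: "hall_form f (\<Prod>i = 0..<N. hsym (int (\<mu> ! i) + int (p i) - int i)) =
      lookup (theta N f * single (pm_nth (?w p)) 1) (pm_nth ?g)"
    if p: "p permutes {0..<N}" for p
  proof -
    let ?e = "\<lambda>i. int (\<mu> ! i) + int (p i) - int i"
    have pN: "p i < N" if "i < N" for i using p that by (simp add: permutes_in_image)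
    show ?thesis
    proof (cases "\<forall>i<N. 0 \<le> ?e i")
      case True
      let ?b = "map (\<lambda>i. nat (?e i)) [0..<N]"
      \<comment> \<open>The exponent \<open>?g\<close> is \<mu> plus the staircase; removing the
        permuted staircase \<open>?w p\<close> leaves the Jacobi-Trudi indices.\<close>
      have "map2 (+) ?b (?w p) = ?g"
      proof (rule nth_equalityI)
        fix j assume "j < length (map2 (+) ?b (?w p))"
        then have j: "j < N" by simp
        then show "map2 (+) ?b (?w p) ! j = ?g ! j"
          using True pN[OF j] by (auto simp: algebra_simps)
      qed simp
      then have g: "pm_nth ?g = pm_nth ?b + pm_nth (?w p)"
        by (subst pm_nth_add) simp_all
      have "lookup (theta N f * single (pm_nth (?w p)) 1) (pm_nth ?g) = lookup (theta N f) (pm_nth ?b)"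
        unfolding g lookup_mult_single_add by simp
      also have "\<dots> = const_term (H_ops ?b f)"
        using lookup_theta[of ?b f] by simp
      finally show ?thesis
        unfolding prod_hsym_eq if_P[OF True] hall_form_hprod by simp
    next
      case False
      then obtain i where i: "i < N" "?e i < 0" by (auto simp: not_le)
      have "lookup (theta N f * single (pm_nth (?w p)) 1) (pm_nth ?g) = 0"
      proof (rule lookup_mult_single_eq_0)
        fix u
        \<comment> \<open>A negative index of h means that the exponent of x_i in \<open>?g\<close>
          is too small for divisibility by the monomial of \<open>?w p\<close>.\<close>
        have "lookup (pm_nth ?g) i < lookup (pm_nth (?w p)) i"
          using i pN[OF i(1)] by (auto simp: lookup_pm_nth simp del: Poly_Mapping.lookup_nth)
        then show "pm_nth ?g \<noteq> u + pm_nth (?w p)"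
          by (metis lookup_add not_add_less2)
      qed
      then show ?thesis
        unfolding prod_hsym_eq if_not_P[OF False]
        by (simp add: additive_uminus_sum[of "hall_form f", OF hall_form_add_right])
    qed
  qed
  have "hall_form f (schur \<mu>) = (\<Sum>p | p permutes {0..<N}. signof p *
      hall_form f (\<Prod>i = 0..<N. hsym (int (\<mu> ! i) + int (p i) - int i)))"
    unfolding schur_expand additive_uminus_sum(3)[of "hall_form f", OF hall_form_add_right]
      hall_form_signof_mult N_def ..
  also have "\<dots> = (\<Sum>p | p permutes {0..<N}. signof p *
      lookup (theta N f * single (pm_nth (?w p)) 1) (pm_nth ?g))"
    by (intro sum.cong refl) (simp only: summand mem_Collect_eq)
  also have "\<dots> = lookup (theta N f * (\<Sum>p | p permutes {0..<N}. signof p * single (pm_nth (?w p)) 1)) (pm_nth ?g)"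
    unfolding sum_distrib_left lookup_sum
    by (intro sum.cong refl) (simp only: mult.left_commute[of "theta N f"] lookup_signof_mult)
  also have "(\<Sum>p | p permutes {0..<N}. signof p * single (pm_nth (?w p)) 1) = alternant (replicate N 0)"
    unfolding alternant_expand length_replicate
    by (intro sum.cong refl arg_cong2[where f = "(*)"] arg_cong2[where f = single] arg_cong[where f = pm_nth])
       (auto simp: permutes_in_image)
  finally show ?thesis .
qed

lemma strict_mono_permutation_eq_id:
  fixes N :: nat
  assumes p: "p permutes {0..<N}" and mono: "\<And>i j. i < j \<Longrightarrow> j < N \<Longrightarrow> p i < p j"
  shows "p = id"
proof -
  have "p j = j" if "j < N" for j
    using that
  proof (induction j rule: less_induct)
    case (less j)
    have "j \<in> p ` {0..<N}" using less.prems permutes_image[OF p] by simp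
    then obtain i where i: "i < N" "p i = j" by auto
    show ?case
    proof (cases i j rule: linorder_cases)
      case greater
      then have "p j < j" using mono[of j i] i by simp
      then have "p (p j) = p j" using less by simp
      then show ?thesis using injD[OF permutes_inj[OF p], of "p j" j] by simp
    qed (use less i in auto)
  qed
  then show ?thesis using p by (metis atLeastLessThan_iff eq_id_iff permutes_not_in zero_le)
qed

text \<open>By the bialternant formula this is the coefficient of x^(\<mu>+\<delta>) in the
  alternant of \<nu>, where \<delta> is the staircase. Both shifted exponents strictly decrease, so
  only the identity permutation can match.\<close>

lemma hall_form_schur_schur:
  assumes len: "length \<nu> = N" "length \<mu> = N"
    and sorted: "sorted_wrt (\<ge>) \<nu>" "sorted_wrt (\<ge>) \<mu>"
  shows "hall_form (schur \<nu>) (schur \<mu>) = (if \<nu> = \<mu> then 1 else 0)"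
proof -
  let ?g = "map (\<lambda>j. \<mu> ! j + (N - 1 - j)) [0..<N]"
  let ?l = "\<lambda>p. map (\<lambda>j. \<nu> ! p j + (N - 1 - p j)) [0..<N]"
  have pm: "pm_nth as = pm_nth bs \<longleftrightarrow> as = bs" if "length as = length bs" for as bs :: "nat list"
  proof
    assume eq: "pm_nth as = pm_nth bs"
    show "as = bs"
    proof (rule nth_equalityI[OF that])
      fix i assume "i < length as"
      then show "as ! i = bs ! i"
        using arg_cong[OF eq, of "\<lambda>v. lookup v i"] that unfolding lookup_pm_nth by simp
    qed
  qed simp
  have "hall_form (schur \<nu>) (schur \<mu>) = lookup (alternant \<nu>) (pm_nth ?g)"
    unfolding hall_form_schur alternant_eq_theta_schur[OF len(1)] len by (simp add: mult.commute)
  also have "\<dots> = (\<Sum>p | p permutes {0..<N}. if ?l p = ?g then signof p else 0)"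
    unfolding alternant_expand lookup_sum len lookup_signof_mult lookup_single
    by (intro sum.cong refl) (simp add: when_def pm)
  also have "\<dots> = (\<Sum>p \<in> {id :: nat \<Rightarrow> nat}. if \<nu> = \<mu> then 1 else 0)"
  proof (rule sum.mono_neutral_cong)
    have dec: "as ! i + (N - 1 - i) > as ! j + (N - 1 - j) \<longleftrightarrow> i < j"
      if "length as = N" "sorted_wrt (\<ge>) as" "i < N" "j < N" for as :: "nat list" and i j
    proof -
      have "as ! j \<le> as ! i" if "i < j" "j < N" for i j
        using sorted_wrt_nth_less[OF \<open>sorted_wrt (\<ge>) as\<close> that(1)] that \<open>length as = N\<close> by simp
      from this[of i j] this[of j i] show ?thesis using that by (cases i j rule: linorder_cases) auto
    qed
    fix p assume "p \<in> {p. p permutes {0..<N}} - {id}"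
    then have p: "p permutes {0..<N}" "p \<noteq> id" by auto
    have pN: "p i < N" if "i < N" for i using p(1) that by (simp add: permutes_in_image)
    have "?l p \<noteq> ?g"
    proof
      assume eq: "?l p = ?g"
      have e: "\<nu> ! p j + (N - 1 - p j) = \<mu> ! j + (N - 1 - j)" if "j < N" for j
        using arg_cong[OF eq, of "\<lambda>xs. xs ! j"] that by simp
      \<comment> \<open>The permuted entries of \<nu>+\<delta> decrease along with those of
        \<mu>+\<delta>, which forces \<open>p\<close> to increase.\<close>
      have "p i < p j" if "i < j" "j < N" for i j
        using dec[OF len(2) sorted(2), of i j] dec[OF len(1) sorted(1), of "p i" "p j"] e[of i] e[of j]
          that pN[of i] pN[of j] by simp
      then show False using strict_mono_permutation_eq_id[OF p(1)] p(2) by blast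
    qed
    then show "(if ?l p = ?g then signof p else 0) = 0" by (rule if_not_P)
  next
    fix p :: "nat \<Rightarrow> nat" assume "p \<in> {p. p permutes {0..<N}} \<inter> {id}"
    then have "p = id" by simp
    moreover have "?l id = ?g \<longleftrightarrow> \<nu> = \<mu>"
      using len by (auto simp: list_eq_iff_nth_eq)
    ultimately show "(if ?l p = ?g then signof p else 0) = (if \<nu> = \<mu> then 1 else 0)" by simp
  qed (auto simp: finite_permutations permutes_id)
  finally show ?thesis by simp
qed

text \<open>The new last row is (0, ..., 0, 1), since h has negative index left of the diagonal;
  expansion along it removes it.\<close>

lemma schur_append_0: "schur (\<alpha> @ [0]) = schur \<alpha>"
proof -
  let ?N = "length \<alpha>"
  let ?A = "mat (Suc ?N) (Suc ?N) (\<lambda>(i, j). hsym (int ((\<alpha> @ [0]) ! i) + int j - int i))"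
  have "schur (\<alpha> @ [0]) = det ?A" by (simp add: schur_def)
  also have "\<dots> = (\<Sum>j<Suc ?N. ?A $$ (?N, j) * cofactor ?A ?N j)"
    by (rule laplace_expansion_row[of _ "Suc ?N"]) simp_all
  also have "\<dots> = (\<Sum>j\<in>{?N}. ?A $$ (?N, j) * cofactor ?A ?N j)"
    by (rule sum.mono_neutral_right) auto
  also have "\<dots> = det (mat_delete ?A ?N ?N)" by (simp add: cofactor_def)
  also have "mat_delete ?A ?N ?N = mat ?N ?N (\<lambda>(i, j). hsym (int (\<alpha> ! i) + int j - int i))"
    by (rule eq_matI) (simp_all add: mat_delete_def nth_append)
  finally show ?thesis by (simp add: schur_def)
qed

lemma schur_append_zeros: "schur (\<alpha> @ replicate n 0) = schur \<alpha>"
proof (induction n)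
  case (Suc n)
  have "\<alpha> @ replicate (Suc n) 0 = (\<alpha> @ replicate n 0) @ [0]"
    by (simp add: replicate_append_same)
  then show ?case using schur_append_0[of "\<alpha> @ replicate n 0"] Suc by (simp only:)
qed simp

lemma is_hall_form_hall_form: "is_hall_form hall_form"
  unfolding is_hall_form_def
proof (intro conjI allI ballI)
  fix p q assume pq: "p \<in> partitions" "q \<in> partitions"
  \<comment> \<open>Zeros bring both partitions to a common length, as the pairing formula requires;
    filtering them out recovers the partitions, whose parts are nonzero.\<close>
  let ?p = "p @ replicate (max (length p) (length q) - length p) 0"
  let ?q = "q @ replicate (max (length p) (length q) - length q) 0"
  have z: "sorted_wrt (\<ge>) (replicate n (0 :: nat))" for n by (induction n) auto
  have "hall_form (schur ?p) (schur ?q) = (if ?p = ?q then 1 else 0)"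
    by (rule hall_form_schur_schur[of _ "max (length p) (length q)"])
       (use pq in \<open>auto simp: partitions_def sorted_wrt_append z\<close>)
  moreover have "?p = ?q \<longleftrightarrow> p = q"
  proof
    assume "?p = ?q"
    then have "filter (\<lambda>x. x \<noteq> 0) ?p = filter (\<lambda>x. x \<noteq> 0) ?q" by simp
    moreover have "filter (\<lambda>x. x \<noteq> 0) p = p" "filter (\<lambda>x. x \<noteq> 0) q = q"
      using pq by (auto simp: partitions_def filter_id_conv intro: gr0I)
    ultimately show "p = q" by simp
  qed simp
  ultimately show "hall_form (schur p) (schur q) = (if p = q then 1 else 0)"
    by (simp add: schur_append_zeros)
qed (simp_all add: hall_form_add_left hall_form_add_right)

section \<open>Schur functions span\<close>

lemma sum_upto_card_le:
  assumes "finite (A :: nat set)"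
  shows "\<Sum>{0..<card A} \<le> \<Sum>A"
  using assms
proof (induction A rule: finite_linorder_max_induct)
  case (insert b A)
  \<comment> \<open>The maximum \<open>b\<close> is at least the number of remaining elements, which
    is the summand it has to dominate.\<close>
  have "A \<subseteq> {0..<b}" using insert by auto
  then have "card A \<le> b" using card_mono[of "{0..<b}" A] by simp
  moreover have "b \<notin> A" using insert by auto
  ultimately show ?case using insert by simp
qed simp

lemma down_closed_eq_upto_card:
  assumes "finite (J :: nat set)" and "\<And>i j. j \<in> J \<Longrightarrow> i < j \<Longrightarrow> i \<in> J"
  shows "J = {0..<card J}"
proof -
  obtain m where m: "m \<notin> J" "\<And>i. i < m \<Longrightarrow> i \<in> J"
    using ex_new_if_finite[OF infinite_UNIV_nat assms(1)] exists_least_iff[of "\<lambda>m. m \<notin> J"] by blast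
  then have "J = {0..<m}" using assms(2) by (auto simp: not_less[symmetric]) (metis linorder_neqE_nat)
  then show ?thesis by simp
qed

text \<open>Slices \<open>p\<close> into layers. As \<open>p\<close> decreases weakly, each
  superlevel set \<open>J t\<close> is an initial segment, on which any \<open>w\<close> takes
  distinct values with sum at least that of the segment.\<close>

lemma sum_mult_permutation_ge:
  fixes p :: "nat \<Rightarrow> nat"
  assumes w: "w permutes {0..<n}" and anti: "\<And>i j. i < j \<Longrightarrow> j < n \<Longrightarrow> p j \<le> p i"
  shows "(\<Sum>j = 0..<n. p j * j) \<le> (\<Sum>j = 0..<n. p j * w j)"
proof -
  define M where "M = (\<Sum>j = 0..<n. p j)"
  define J where "J t = {j \<in> {0..<n}. t < p j}" for t
  have le: "p j \<le> M" if "j \<in> {0..<n}" for j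
    unfolding M_def using that by (intro member_le_sum) auto
  have layer: "(\<Sum>j = 0..<n. p j * f j) = (\<Sum>t<M. \<Sum>j\<in>J t. f j)" for f :: "nat \<Rightarrow> nat"
  proof -
    have "p j * f j = (\<Sum>t<M. if t < p j then f j else 0)" if "j \<in> {0..<n}" for j
    proof -
      have "{..<M} \<inter> {t. t < p j} = {..<p j}" using le[OF that] by auto
      then show ?thesis by (simp add: sum.If_cases)
    qed
    then have "(\<Sum>j = 0..<n. p j * f j) = (\<Sum>j = 0..<n. \<Sum>t<M. if t < p j then f j else 0)"
      by (intro sum.cong) auto
    also have "\<dots> = (\<Sum>t<M. \<Sum>j = 0..<n. if t < p j then f j else 0)"
      by (rule sum.swap)
    also have "\<dots> = (\<Sum>t<M. \<Sum>j\<in>J t. f j)"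
      unfolding J_def by (intro sum.cong refl sum.inter_filter[symmetric]) simp
    finally show ?thesis .
  qed
  have "(\<Sum>j\<in>J t. j) \<le> (\<Sum>j\<in>J t. w j)" for t
  proof -
    have fin: "finite (J t)" by (simp add: J_def)
    have "J t = {0..<card (J t)}"
    proof (rule down_closed_eq_upto_card[OF fin])
      fix i j assume "j \<in> J t" "i < j"
      then show "i \<in> J t" using anti[of i j] by (simp add: J_def)
    qed
    moreover have inj: "inj_on w (J t)" using permutes_inj[OF w] by (rule inj_on_subset) simp
    then have "card (w ` J t) = card (J t)" by (rule card_image)
    ultimately have "\<Sum>(J t) \<le> \<Sum>(w ` J t)"
      using sum_upto_card_le[of "w ` J t"] fin by simp
    also have "\<dots> = (\<Sum>j\<in>J t. w j)" by (rule sum.reindex_cong[OF inj]) auto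
    finally show ?thesis .
  qed
  then show ?thesis unfolding layer by (rule sum_mono)
qed

text \<open>Expanding the squares leaves a cross term, nonnegative by rearrangement, and the squares
  of \<open>w j - j\<close>, not all zero.\<close>

lemma sum_squares_permutation_greater:
  fixes p :: "nat \<Rightarrow> nat"
  assumes w: "w permutes {0..<n}" "w \<noteq> id" and anti: "\<And>i j. i < j \<Longrightarrow> j < n \<Longrightarrow> p j \<le> p i"
  shows "(\<Sum>j = 0..<n. (int (p j))\<^sup>2) < (\<Sum>j = 0..<n. (int (p j) + int (w j) - int j)\<^sup>2)"
proof -
  obtain i where i: "w i \<noteq> i" using w(2) by (metis eq_id_iff)
  then have "i \<in> {0..<n}" using w(1) permutes_not_in by metis
  then have pos: "0 < (\<Sum>j = 0..<n. (int (w j) - int j)\<^sup>2)"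
    using i by (intro sum_pos2[of _ i]) auto
  have "(\<Sum>j = 0..<n. int (p j) * int j) \<le> (\<Sum>j = 0..<n. int (p j) * int (w j))"
    using sum_mult_permutation_ge[of w n p, OF w(1) anti] by (simp flip: of_nat_mult of_nat_sum)
  moreover have "(\<Sum>j = 0..<n. (int (p j) + int (w j) - int j)\<^sup>2) =
      (\<Sum>j = 0..<n. (int (p j))\<^sup>2) + 2 * ((\<Sum>j = 0..<n. int (p j) * int (w j)) - (\<Sum>j = 0..<n. int (p j) * int j))
      + (\<Sum>j = 0..<n. (int (w j) - int j)\<^sup>2)"
    unfolding sum_distrib_left sum_subtractf[symmetric] sum.distrib[symmetric]
    by (intro sum.cong refl) (simp add: power2_eq_square algebra_simps)
  moreover have "q < s" if "a \<le> b" "s = q + 2 * (b - a) + d" "0 < d" for a b s q d :: int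
  proof -
    have "q < q + d" using that(3) by simp
    also have "\<dots> \<le> s" using that(1) unfolding that(2) by simp
    finally show ?thesis .
  qed
  ultimately show ?thesis using pos by blast
qed

lemma sum_list_squares_le: "(\<Sum>b\<leftarrow>bs. b\<^sup>2) \<le> (sum_list bs :: nat)\<^sup>2"
  by (induction bs) (auto simp: power2_sum)

lemma hprod_mset_cong: "mset as = mset bs \<Longrightarrow> hprod as = hprod bs"
  unfolding hprod_def by (metis mset_map prod_mset_prod_list)

lemma hprod_filter: "hprod (filter (\<lambda>b. b \<noteq> 0) bs) = hprod bs"
  by (induction bs) simp_all

text \<open>Rewriting \<open>h\<^sub>\<mu>\<close> by the Jacobi-Trudi determinant of \<open>\<mu>\<close> leaves terms \<open>h\<^sub>\<beta>\<close> with \<open>|\<beta>| = |\<mu>|\<close> and a larger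
  sum of squares, which is bounded by \<open>|\<mu>|\<^sup>2\<close>.\<close>

lemma schur_span:
  assumes schur: "\<And>p. p \<in> partitions \<Longrightarrow> P (schur p)"
    and add: "\<And>f g. P f \<Longrightarrow> P g \<Longrightarrow> P (f + g)"
    and uminus: "\<And>f. P f \<Longrightarrow> P (- f)"
  shows "P f"
proof -
  have z: "P 0"
    using add[OF schur uminus[OF schur], of "[]" "[]"] by (simp add: partitions_def)
  have P_sum: "P (sum g A)" if "\<And>x. x \<in> A \<Longrightarrow> P (g x)" for g and A :: "(nat \<Rightarrow> nat) set"
    using that by (induction A rule: infinite_finite_induct) (auto intro: z add)
  have P_sign: "P (signof p * g)" if "P g" for p g
    using that uminus[OF that] by (simp add: sign_def)
  have "P (hprod bs)" for bs
  \<comment> \<open>\<open>sum_list_squares_le\<close> ensures that this subtraction of naturals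
    does not truncate.\<close>
  proof (induction bs rule: measure_induct_rule[of "\<lambda>bs. (sum_list bs)\<^sup>2 - (\<Sum>b\<leftarrow>bs. b\<^sup>2)"])
    case (less bs)
    \<comment> \<open>Sorting and dropping zeros yields a partition with the same product of h's and
      the same measure.\<close>
    define q where "q = rev (sort (filter (\<lambda>b. b \<noteq> 0) bs))"
    define n where "n = length q"
    have ms: "mset q = mset (filter (\<lambda>b. b \<noteq> 0) bs)" by (simp add: q_def)
    have hq: "hprod q = hprod bs" using hprod_mset_cong[OF ms] hprod_filter by (rule trans)
    have "sum_list q = sum_list (filter (\<lambda>b. b \<noteq> 0) bs)"
      using arg_cong[OF ms, of sum_mset] by (simp only: sum_mset_sum_list)
    also have "\<dots> = sum_list bs" by (induction bs) simp_all
    finally have s1: "sum_list q = sum_list bs" .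
    have "(\<Sum>b\<leftarrow>q. b\<^sup>2) = (\<Sum>b\<leftarrow>filter (\<lambda>b. b \<noteq> 0) bs. b\<^sup>2)"
      using arg_cong[OF ms, of "\<lambda>M. sum_mset (image_mset (\<lambda>b. b\<^sup>2) M)"]
      by (simp only: flip: mset_map sum_mset_sum_list)
    also have "\<dots> = (\<Sum>b\<leftarrow>bs. b\<^sup>2)" by (induction bs) simp_all
    finally have s2: "(\<Sum>b\<leftarrow>q. b\<^sup>2) = (\<Sum>b\<leftarrow>bs. b\<^sup>2)" .
    have sorted: "sorted_wrt (\<ge>) q" by (simp add: q_def sorted_wrt_rev)
    then have qp: "q \<in> partitions" by (simp add: partitions_def q_def)
    let ?T = "\<lambda>w. \<Prod>i = 0..<n. hsym (int (q ! i) + int (w i) - int i)"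
    have T: "P (signof w * ?T w)" if "w \<in> {w. w permutes {0..<n}} - {id}" for w
    proof (rule P_sign)
      have w: "w permutes {0..<n}" "w \<noteq> id" using that by auto
      let ?e = "\<lambda>i. int (q ! i) + int (w i) - int i"
      show "P (?T w)"
      proof (cases "\<forall>i<n. 0 \<le> ?e i")
        case True
        let ?b = "map (\<lambda>i. nat (?e i)) [0..<n]"
        have "int (sum_list ?b) = (\<Sum>i = 0..<n. ?e i)"
          unfolding interv_sum_list_conv_sum_set_nat of_nat_sum using True by (intro sum.cong) auto
        also have "\<dots> = (\<Sum>i = 0..<n. int (q ! i)) + ((\<Sum>i = 0..<n. int (w i)) - (\<Sum>i = 0..<n. int i))"
          by (simp add: sum.distrib sum_subtractf)
        also have "(\<Sum>i = 0..<n. int (w i)) = (\<Sum>i = 0..<n. int i)"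
          using sum.permute[OF w(1), of int] by (simp add: comp_def)
        also have "(\<Sum>i = 0..<n. int (q ! i)) = int (sum_list q)"
          by (simp add: sum_list_sum_nth n_def)
        finally have b1: "sum_list ?b = sum_list bs" using s1 by simp
        have "int (\<Sum>b\<leftarrow>q. b\<^sup>2) = (\<Sum>i = 0..<n. (int (q ! i))\<^sup>2)"
          by (simp add: sum_list_sum_nth n_def)
        also have "\<dots> < (\<Sum>i = 0..<n. (?e i)\<^sup>2)"
          by (rule sum_squares_permutation_greater[OF w])
             (use sorted_wrt_nth_less[OF sorted] n_def in auto)
        also have "\<dots> = int (\<Sum>b\<leftarrow>?b. b\<^sup>2)"
          unfolding map_map interv_sum_list_conv_sum_set_nat of_nat_sum using True by (intro sum.cong) auto
        finally have "(\<Sum>b\<leftarrow>bs. b\<^sup>2) < (\<Sum>b\<leftarrow>?b. b\<^sup>2)" unfolding s2 by simp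
        then have "(sum_list ?b)\<^sup>2 - (\<Sum>b\<leftarrow>?b. b\<^sup>2) < (sum_list bs)\<^sup>2 - (\<Sum>b\<leftarrow>bs. b\<^sup>2)"
          using sum_list_squares_le[of ?b] unfolding b1 by linarith
        then have "P (hprod ?b)" by (rule less)
        then show ?thesis unfolding prod_hsym_eq if_P[OF True] .
      next
        case False
        show ?thesis unfolding prod_hsym_eq if_not_P[OF False] by (rule z)
      qed
    qed
    \<comment> \<open>The identity permutation contributes the product itself; all other terms fall
      under the induction hypothesis or vanish.\<close>
    have "?T id = hprod q"
      unfolding prod_hsym_eq by (simp add: n_def map_nth)
    moreover have "schur q = signof id * ?T id + (\<Sum>w\<in>{w. w permutes {0..<n}} - {id}. signof w * ?T w)"
      unfolding schur_expand n_def[symmetric]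
      by (rule sum.remove) (auto simp: finite_permutations permutes_id)
    ultimately have eq: "hprod bs = schur q + - (\<Sum>w\<in>{w. w permutes {0..<n}} - {id}. signof w * ?T w)"
      using hq by simp
    show ?case unfolding eq by (intro add schur[OF qp] uminus P_sum T)
  qed
  then show ?thesis using add uminus by (rule symf_induct)
qed

section \<open>Uniqueness and nondegeneracy of the Hall form\<close>

lemma additive_eqI_schur:
  fixes A B :: "symf \<Rightarrow> int"
  assumes "\<And>f g. A (f + g) = A f + A g" "\<And>f g. B (f + g) = B f + B g"
    and "\<And>p. p \<in> partitions \<Longrightarrow> A (schur p) = B (schur p)"
  shows "A f = B f"
  by (induction f rule: schur_span) (simp_all add: assms additive_uminus_sum(2)[of A] additive_uminus_sum(2)[of B])

lemma hall_eq_hall_form: "hall = hall_form"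
  unfolding hall_def
proof (rule the_equality[where P = is_hall_form])
  show "is_hall_form hall_form" by (rule is_hall_form_hall_form)
  fix B assume B: "is_hall_form B"
  show "B = hall_form"
  proof (intro ext)
    fix f c
    have add: "B (f + g) h = B f h + B g h" "B h (f + g) = B h f + B h g" for f g h
      using B unfolding is_hall_form_def by simp_all
    have schur: "B (schur p) (schur q) = hall_form (schur p) (schur q)"
      if "p \<in> partitions" "q \<in> partitions" for p q
      using B is_hall_form_hall_form that unfolding is_hall_form_def by simp
    \<comment> \<open>Agreement extends from Schur functions in the right argument first, then in
      the left.\<close>
    have eq: "B (schur p) c = hall_form (schur p) c" if "p \<in> partitions" for p
      by (rule additive_eqI_schur[of "B (schur p)"]) (use that in \<open>simp_all add: add schur hall_form_add_right\<close>)
    show "B f c = hall_form f c"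
      using add(1) hall_form_add_left eq by (rule additive_eqI_schur[of "\<lambda>f. B f c" "\<lambda>f. hall_form f c"])
  qed
qed

lemma schur_expansion:
  obtains K c where "finite K" "K \<subseteq> partitions" "f = (\<Sum>p\<in>K. of_int (c p) * schur p)"
proof -
  have "\<exists>K c. finite K \<and> K \<subseteq> partitions \<and> f = (\<Sum>p\<in>K. of_int (c p) * schur p)"
  proof (induction f rule: schur_span)
    case (1 p)
    then show ?case by (intro exI[of _ "{p}"] exI[of _ "\<lambda>_. 1"]) simp
  next
    case (2 f g)
    then obtain K c L d where *: "finite K" "K \<subseteq> partitions" "f = (\<Sum>p\<in>K. of_int (c p) * schur p)"
      "finite L" "L \<subseteq> partitions" "g = (\<Sum>p\<in>L. of_int (d p) * schur p)" by blast
    have "f = (\<Sum>p\<in>K \<union> L. of_int (if p \<in> K then c p else 0) * schur p)"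
      unfolding *(3) by (rule sum.mono_neutral_cong_left) (use * in auto)
    moreover have "g = (\<Sum>p\<in>K \<union> L. of_int (if p \<in> L then d p else 0) * schur p)"
      unfolding *(6) by (rule sum.mono_neutral_cong_left) (use * in auto)
    ultimately have "f + g = (\<Sum>p\<in>K \<union> L. of_int ((if p \<in> K then c p else 0) + (if p \<in> L then d p else 0)) * schur p)"
      by (simp only: sum.distrib of_int_add distrib_right)
    then show ?case
      by (intro exI[of _ "K \<union> L"] exI[of _ "\<lambda>p. (if p \<in> K then c p else 0) + (if p \<in> L then d p else 0)"] conjI)
         (use * in auto)
  next
    case (3 f)
    then obtain K c where "finite K" "K \<subseteq> partitions" "f = (\<Sum>p\<in>K. of_int (c p) * schur p)" by blast
    then show ?case
      by (intro exI[of _ K] exI[of _ "\<lambda>p. - c p"]) (simp add: sum_negf)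
  qed
  then show ?thesis using that by blast
qed

lemma hall_form_of_int_mult_left: "hall_form (of_int c * f) g = of_int c * hall_form f g"
proof -
  note L = additive_uminus_sum[of "\<lambda>f. hall_form f g", OF hall_form_add_left]
  have "hall_form (of_nat n * f) g = of_nat n * hall_form f g" for n
    by (induction n) (simp_all add: L algebra_simps hall_form_add_left)
  then show ?thesis by (cases c rule: int_cases2) (simp_all add: L)
qed

text \<open>Pairing with a Schur function reads off its coefficient in a Schur expansion of
  \<open>f\<close>.\<close>

lemma hall_form_nondegenerate:
  assumes "\<And>c. hall_form f c = 0"
  shows "f = 0"
proof -
  obtain K c where K: "finite K" "K \<subseteq> partitions" "f = (\<Sum>p\<in>K. of_int (c p) * schur p)"
    by (rule schur_expansion)
  have "c q = 0" if q: "q \<in> K" for q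
  proof -
    have "hall_form f (schur q) = (\<Sum>p\<in>K. c p * hall_form (schur p) (schur q))"
      unfolding K(3) additive_uminus_sum(3)[of "\<lambda>f. hall_form f (schur q)", OF hall_form_add_left]
      by (simp add: hall_form_of_int_mult_left)
    also have "\<dots> = (\<Sum>p\<in>K. if p = q then c p else 0)"
      using is_hall_form_hall_form K(2) q unfolding is_hall_form_def
      by (intro sum.cong refl) (auto simp: subset_iff)
    finally show ?thesis using assms q K(1) by simp
  qed
  then show ?thesis unfolding K(3) by simp
qed

text \<open>Adjointness of \<open>E_op\<close> gives existence and nondegeneracy gives uniqueness
  for the description in \<open>perp\<close>.\<close>

lemma perp_esym: "perp (esym d) a = E_op d a"
  unfolding perp_def hall_eq_hall_form
proof (rule the_equality)
  show "\<forall>c. hall_form (E_op d a) c = hall_form a (esym d * c)"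
    by (simp add: hall_form_esym_mult)
  fix b assume b: "\<forall>c. hall_form b c = hall_form a (esym d * c)"
  have "hall_form (b - E_op d a) c = 0" for c
    using hall_form_add_left[of "b - E_op d a" "E_op d a" c] b by (simp add: hall_form_esym_mult)
  then show "b = E_op d a" using hall_form_nondegenerate[of "b - E_op d a"] by simp
qed

section \<open>Katalan functions\<close>

lemma coeff_signof_mult: "coeff (signof p * q) m = signof p * coeff q m"
  by (simp add: sign_def)

lemma prod_linear_coeff:
  fixes a b :: "nat \<Rightarrow> 'a :: comm_ring_1"
  defines "P \<equiv> \<lambda>n. \<Prod>i = 0..<n. [:a i, b i:]"
  shows "coeff (P n) n = (\<Prod>i = 0..<n. b i)" and "m > n \<Longrightarrow> coeff (P n) m = 0"
proof -
  have "coeff (P n) n = (\<Prod>i = 0..<n. b i) \<and> (\<forall>m>n. coeff (P n) m = 0)"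
  proof (induction n)
    case (Suc n)
    have "P (Suc n) = [:a n, b n:] * P n"
      by (simp add: P_def mult.commute)
    then have "coeff (P (Suc n)) (Suc m) = a n * coeff (P n) (Suc m) + b n * coeff (P n) m" for m
      by simp
    then show ?case using Suc by (auto simp: mult.commute elim!: Suc_lessE)
  qed (simp add: P_def coeff_1)
  then show "coeff (P n) n = (\<Prod>i = 0..<n. b i)" and "m > n \<Longrightarrow> coeff (P n) m = 0" by auto
qed

text \<open>Every Leibniz term is a product of \<open>n\<close> linear polynomials: its degree is at
  most \<open>n\<close>, and its coefficient of u^n is the product of the linear
  coefficients.\<close>

lemma det_linear_coeff:
  fixes a b :: "nat \<Rightarrow> nat \<Rightarrow> 'a :: comm_ring_1" and n :: nat
  defines "D \<equiv> det (mat n n (\<lambda>(i, j). [:a i j, b i j:]))"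
  shows "coeff D n = det (mat n n (\<lambda>(i, j). b i j))" and "m > n \<Longrightarrow> coeff D m = 0"
proof -
  have D: "D = (\<Sum>p | p permutes {0..<n}. signof p * (\<Prod>i = 0..<n. [:a i (p i), b i (p i):]))"
    by (simp add: D_def det_mat)
  have B: "det (mat n n (\<lambda>(i, j). b i j)) =
      (\<Sum>p | p permutes {0..<n}. signof p * (\<Prod>i = 0..<n. b i (p i)))"
    by (simp add: det_mat)
  show "coeff D n = det (mat n n (\<lambda>(i, j). b i j))"
    unfolding D B coeff_sum coeff_signof_mult prod_linear_coeff(1) ..
  show "coeff D m = 0" if "m > n"
    unfolding D coeff_sum coeff_signof_mult prod_linear_coeff(2)[OF that] by simp
qed

lemma E_hom_of_int: "E_hom (of_int c) = [:of_int c:]"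
  by (simp add: E_hom.hom_of_int of_int_poly)

lemma kcomp_neg: "m < 0 \<Longrightarrow> kcomp r m = 0"
  by (simp add: kcomp_def)

lemma E_hom_kcomp: "E_hom (kcomp r m) = [:kcomp r m, kcomp r (m - 1):]"
proof -
  let ?c = "\<lambda>i. of_int (int_binom (r + i - 1) (nat i)) :: symf"
  have pc: "(\<Sum>i\<in>A. [:u i, v i:]) = [:\<Sum>i\<in>A. u i, \<Sum>i\<in>A. v i:]"
    if "finite A" for A :: "int set" and u v :: "int \<Rightarrow> symf"
    using that by (induction A rule: finite_induct) simp_all
  \<comment> \<open>Both sums may run to \<open>m\<close>: the extra term contains h_(-1) =
    0.\<close>
  have k: "kcomp r (m - 1) = (\<Sum>i\<in>{0..m}. ?c i * hsym (m - i - 1))"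
    unfolding kcomp_def
    by (rule sum.mono_neutral_cong_left) (auto simp: algebra_simps)
  have "E_hom (kcomp r m) = (\<Sum>i\<in>{0..m}. [:?c i * hsym (m - i), ?c i * hsym (m - i - 1):])"
    unfolding kcomp_def
    by (simp add: E_hom.hom_sum E_hom.hom_mult E_hom_hsym E_hom_of_int mult.commute)
  then show ?thesis
    unfolding k unfolding kcomp_def by (simp add: pc)
qed

lemma E_hom_gdet:
  "E_hom (gdet \<gamma>) = det (mat (length \<gamma>) (length \<gamma>)
     (\<lambda>(i, j). [:kcomp (int i) (\<gamma> ! i + int j - int i), kcomp (int i) (\<gamma> ! i + int j - int i - 1):]))"
  unfolding gdet_def E_hom.hom_det[symmetric]
  by (rule arg_cong[where f = det]) (auto intro!: eq_matI simp: E_hom_kcomp)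

text \<open>The linear coefficients have index lowered by one, which undoes the shift of
  \<gamma>.\<close>

lemma E_op_gdet_shift: "E_op (length \<gamma>) (gdet (map (\<lambda>x. x + 1) \<gamma>)) = gdet \<gamma>"
  unfolding E_op_def E_hom_gdet
  by (simp add: det_linear_coeff(1))
     (auto simp: gdet_def algebra_simps intro!: arg_cong[where f = det] eq_matI)

lemma E_op_gdet_eq_0: "m > length \<gamma> \<Longrightarrow> E_op m (gdet \<gamma>) = 0"
  unfolding E_op_def E_hom_gdet by (rule det_linear_coeff(2))

text \<open>Row \<open>i\<close> is zero, since all its indices are negative.\<close>

lemma gdet_eq_0:
  assumes "i < length \<alpha>" "\<alpha> ! i < - int (length \<alpha>)"
  shows "gdet \<alpha> = 0"
proof -
  let ?A = "mat (length \<alpha>) (length \<alpha>) (\<lambda>(i, j). kcomp (int i) (\<alpha> ! i + int j - int i))"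
  have "(\<Prod>r = 0..<length \<alpha>. ?A $$ (r, p r)) = 0" if "p permutes {0..<length \<alpha>}" for p
  proof (rule prod_zero)
    have "p i < length \<alpha>" using that assms(1) by (simp add: permutes_in_image)
    then have "?A $$ (i, p i) = 0" using assms by (simp add: kcomp_neg)
    then show "\<exists>r\<in>{0..<length \<alpha>}. ?A $$ (r, p r) = 0" using assms(1) by auto
  qed simp
  then have "(\<Sum>p | p permutes {0..<length \<alpha>}. signof p * (\<Prod>r = 0..<length \<alpha>. ?A $$ (r, p r))) = 0"
    by (intro sum.neutral ballI) (simp only: mem_Collect_eq mult_zero_right)
  then show ?thesis unfolding gdet_def by (subst det_def'[of _ "length \<alpha>"]) simp_all
qed

section \<open>Finite support of the Katalan expansion\<close>

lemma finite_pos_roots: "finite (pos_roots l)"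
  by (rule finite_subset[of _ "{..<l} \<times> {..<l}"]) (auto simp: pos_roots_def)

text \<open>Factors z_i/z_j keep the total degree, and each 1/z_j lowers it.\<close>

lemma sum_list_katalan_exponent_le:
  assumes "\<Psi> \<subseteq> pos_roots (length \<gamma>)"
  shows "sum_list (katalan_exponent \<Psi> \<gamma> n S) \<le> sum_list \<gamma>"
proof -
  let ?l = "length \<gamma>"
  have fin: "finite \<Psi>" using assms finite_pos_roots by (rule finite_subset)
  have f: "(\<Sum>s\<in>{0..<?l}. \<Sum>p\<in>{p \<in> \<Psi>. fst p = s}. int (n p)) = (\<Sum>p\<in>\<Psi>. int (n p))"
    using fin assms by (intro sum.group) (auto simp: pos_roots_def)
  have g: "(\<Sum>s\<in>{0..<?l}. \<Sum>p\<in>{p \<in> \<Psi>. snd p = s}. int (n p)) = (\<Sum>p\<in>\<Psi>. int (n p))"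
    using fin assms by (intro sum.group) (auto simp: pos_roots_def)
  have "sum_list (katalan_exponent \<Psi> \<gamma> n S) =
      (\<Sum>s\<in>{0..<?l}. \<gamma> ! s) - (\<Sum>s\<in>{0..<?l}. int (card {p \<in> S. snd p = s}))"
    unfolding katalan_exponent_def interv_sum_list_conv_sum_set_nat
    by (simp add: sum.distrib sum_subtractf f g)
  also have "\<dots> \<le> (\<Sum>s\<in>{0..<?l}. \<gamma> ! s)"
    by (simp add: sum_nonneg)
  also have "\<dots> = sum_list \<gamma>" by (simp add: sum_list_sum_nth)
  finally show ?thesis .
qed

lemma katalan_coeff_nonzeroD:
  assumes "katalan_coeff \<Psi> L \<gamma> \<alpha> \<noteq> 0" and "\<Psi> \<subseteq> pos_roots (length \<gamma>)"
  shows "length \<alpha> = length \<gamma>" and "sum_list \<alpha> \<le> sum_list \<gamma>"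
proof -
  from assms(1) have "{(n, S). (\<forall>p. p \<notin> \<Psi> \<longrightarrow> n p = 0) \<and> S \<subseteq> L \<and> katalan_exponent \<Psi> \<gamma> n S = \<alpha>} \<noteq> {}"
    unfolding katalan_coeff_def by (metis (no_types, lifting) sum.empty)
  then obtain n S where "katalan_exponent \<Psi> \<gamma> n S = \<alpha>" by auto
  then show "length \<alpha> = length \<gamma>" "sum_list \<alpha> \<le> sum_list \<gamma>"
    using sum_list_katalan_exponent_le[OF assms(2), of n S] by (auto simp: katalan_exponent_def)
qed

text \<open>After adding \<open>c\<close> the entries are nonnegative, so each is bounded by their
  sum.\<close>

lemma finite_int_lists_bounded:
  "finite {\<alpha> :: int list. length \<alpha> = l \<and> (\<forall>i<l. - c \<le> \<alpha> ! i) \<and> sum_list \<alpha> \<le> d}"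
proof (rule finite_subset)
  let ?B = "{- c..d + int l * c - c}"
  show "finite {\<alpha>. set \<alpha> \<subseteq> ?B \<and> length \<alpha> = l}"
    by (rule finite_lists_length_eq) simp
  show "{\<alpha>. length \<alpha> = l \<and> (\<forall>i<l. - c \<le> \<alpha> ! i) \<and> sum_list \<alpha> \<le> d} \<subseteq> {\<alpha>. set \<alpha> \<subseteq> ?B \<and> length \<alpha> = l}"
  proof clarsimp
    fix \<alpha> x assume a: "l = length \<alpha>" "\<forall>i<length \<alpha>. - c \<le> \<alpha> ! i" "sum_list \<alpha> \<le> d" "x \<in> set \<alpha>"
    then obtain i where i: "i < length \<alpha>" "x = \<alpha> ! i" by (metis in_set_conv_nth)
    have "\<alpha> ! i + c \<le> (\<Sum>j\<in>{0..<length \<alpha>}. \<alpha> ! j + c)"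
      by (rule member_le_sum) (use a i in \<open>auto simp: add.commute neg_le_iff_le minus_le_iff\<close>)
    also have "\<dots> = sum_list \<alpha> + int (length \<alpha>) * c"
      by (simp add: sum.distrib sum_list_sum_nth)
    finally show "- c \<le> x \<and> x \<le> d + int (length \<alpha>) * c - c"
      using a i by auto
  qed
qed

text \<open>Guards against the default of \<open>Sum_any\<close>, which is 0 on infinite
  support.\<close>

lemma finite_katalan_support:
  assumes "\<Psi> \<subseteq> pos_roots (length \<gamma>)"
  shows "finite {\<alpha>. of_int (katalan_coeff \<Psi> L \<gamma> \<alpha>) * gdet \<alpha> \<noteq> 0}"
proof (rule finite_subset)
  show "finite {\<alpha>. length \<alpha> = length \<gamma> \<and> (\<forall>i<length \<gamma>. - int (length \<gamma>) \<le> \<alpha> ! i) \<and> sum_list \<alpha> \<le> sum_list \<gamma>}"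
    by (rule finite_int_lists_bounded)
  show "{\<alpha>. of_int (katalan_coeff \<Psi> L \<gamma> \<alpha>) * gdet \<alpha> \<noteq> 0} \<subseteq> {\<alpha>. length \<alpha> = length \<gamma> \<and>
      (\<forall>i<length \<gamma>. - int (length \<gamma>) \<le> \<alpha> ! i) \<and> sum_list \<alpha> \<le> sum_list \<gamma>}"
  proof clarify
    fix \<alpha> assume nz: "of_int (katalan_coeff \<Psi> L \<gamma> \<alpha>) * gdet \<alpha> \<noteq> 0"
    then have c: "katalan_coeff \<Psi> L \<gamma> \<alpha> \<noteq> 0" and g: "gdet \<alpha> \<noteq> 0" by auto
    note D = katalan_coeff_nonzeroD[OF c assms]
    show "length \<alpha> = length \<gamma> \<and> (\<forall>i<length \<gamma>. - int (length \<gamma>) \<le> \<alpha> ! i) \<and> sum_list \<alpha> \<le> sum_list \<gamma>"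
      using D gdet_eq_0[of _ \<alpha>] g by (metis not_le)
  qed
qed

section \<open>Translating all exponents by one\<close>

lemma inj_map_add_one: "inj (map (\<lambda>x. x + 1 :: int))"
  by (rule inj_mapI) (simp add: inj_def)

text \<open>Multiplication by z_1 ... z_l translates every exponent and leaves the choices of
  \<open>n\<close> and \<open>S\<close> as they are.\<close>

lemma katalan_coeff_shift:
  "katalan_coeff \<Psi> L (map (\<lambda>x. x + 1) \<gamma>) (map (\<lambda>x. x + 1) \<alpha>) = katalan_coeff \<Psi> L \<gamma> \<alpha>"
proof -
  have "katalan_exponent \<Psi> (map (\<lambda>x. x + 1) \<gamma>) n S = map (\<lambda>x. x + 1) (katalan_exponent \<Psi> \<gamma> n S)" for n S
    by (simp add: katalan_exponent_def)
  then show ?thesis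
    unfolding katalan_coeff_def by (simp add: inj_eq[OF inj_map_add_one])
qed

lemma bij_map_add_one: "bij (map (\<lambda>x. x + 1 :: int))"
proof (rule bijI[OF inj_map_add_one surjI])
  show "map (\<lambda>x. x + 1) (map (\<lambda>x. x - 1) \<alpha>) = \<alpha>" for \<alpha> :: "int list"
    by (simp add: comp_def)
qed

lemma E_op_of_int_mult: "E_op d (of_int c * f) = of_int c * E_op d f"
  by (simp add: E_op_def E_hom.hom_mult E_hom_of_int)

lemma E_op_sum: "E_op d (sum f A) = (\<Sum>x\<in>A. E_op d (f x))"
  by (simp add: E_op_def E_hom.hom_sum coeff_sum)

lemma E_op_katalan_shift:
  assumes "\<Psi> \<subseteq> pos_roots (length \<gamma>)"
  shows "E_op (length \<gamma>) (katalan \<Psi> L (map (\<lambda>x. x + 1) \<gamma>)) = katalan \<Psi> L \<gamma>"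
    and "m > length \<gamma> \<Longrightarrow> E_op m (katalan \<Psi> L (map (\<lambda>x. x + 1) \<gamma>)) = 0"
proof -
  let ?s = "map (\<lambda>x. x + 1 :: int)"
  let ?c = "\<lambda>\<alpha>. of_int (katalan_coeff \<Psi> L \<gamma> \<alpha>) :: symf"
  let ?F = "\<lambda>\<alpha>. of_int (katalan_coeff \<Psi> L (?s \<gamma>) \<alpha>) * gdet \<alpha>"
  \<comment> \<open>The support of the shifted sum, pulled back along the shift; it serves as a
    common finite index set for both sums.\<close>
  define A where "A = {\<alpha>. ?c \<alpha> * gdet (?s \<alpha>) \<noteq> 0}"
  have F: "?F (?s \<alpha>) = ?c \<alpha> * gdet (?s \<alpha>)" for \<alpha>
    by (simp add: katalan_coeff_shift)
  have "finite {\<alpha>. ?F \<alpha> \<noteq> 0}"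
    by (rule finite_katalan_support) (use assms in simp)
  then have "finite (?s -` {\<alpha>. ?F \<alpha> \<noteq> 0})"
    by (rule finite_vimageI[OF _ inj_map_add_one])
  also have "?s -` {\<alpha>. ?F \<alpha> \<noteq> 0} = A"
    unfolding vimage_def mem_Collect_eq F A_def ..
  finally have fin: "finite A" .
  \<comment> \<open>Needed because \<open>E_op_gdet_shift\<close> fixes the operator by the length
    of \<alpha>.\<close>
  have len: "length \<alpha> = length \<gamma>" if "\<alpha> \<in> A" for \<alpha>
    using that katalan_coeff_nonzeroD(1)[OF _ assms] by (auto simp: A_def)
  have "katalan \<Psi> L (?s \<gamma>) = Sum_any (\<lambda>\<alpha>. ?F (?s \<alpha>))"
    unfolding katalan_def by (rule Sum_any.reindex_cong[OF bij_map_add_one]) auto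
  also have "\<dots> = (\<Sum>\<alpha>\<in>A. ?c \<alpha> * gdet (?s \<alpha>))"
    unfolding F by (rule Sum_any.expand_superset[OF fin]) (simp add: A_def)
  finally have k: "katalan \<Psi> L (?s \<gamma>) = (\<Sum>\<alpha>\<in>A. ?c \<alpha> * gdet (?s \<alpha>))" .
  \<comment> \<open>The unshifted term is the image of the shifted one under \<open>E_op\<close>, so
    it vanishes wherever the latter does.\<close>
  have "{\<alpha>. ?c \<alpha> * gdet \<alpha> \<noteq> 0} \<subseteq> A"
  proof clarify
    fix \<alpha> assume "?c \<alpha> * gdet \<alpha> \<noteq> 0"
    moreover have "E_op (length \<alpha>) (?c \<alpha> * gdet (?s \<alpha>)) = ?c \<alpha> * gdet \<alpha>"
      by (simp add: E_op_of_int_mult E_op_gdet_shift)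
    ultimately show "\<alpha> \<in> A" by (auto simp: A_def E_op_def)
  qed
  then have k': "katalan \<Psi> L \<gamma> = (\<Sum>\<alpha>\<in>A. ?c \<alpha> * gdet \<alpha>)"
    unfolding katalan_def by (rule Sum_any.expand_superset[OF fin])
  show "E_op (length \<gamma>) (katalan \<Psi> L (?s \<gamma>)) = katalan \<Psi> L \<gamma>"
    unfolding k k' E_op_sum using len
    by (intro sum.cong refl) (metis E_op_of_int_mult E_op_gdet_shift)
  show "E_op m (katalan \<Psi> L (?s \<gamma>)) = 0" if "m > length \<gamma>"
    unfolding k E_op_sum using len that
    by (intro sum.neutral ballI) (simp add: E_op_of_int_mult E_op_gdet_eq_0)
qed

text \<open>Only the difference of the level and \<mu>_i enters, and both rise by one.\<close>

lemma Delta_shift: "Delta (Suc m) (map (\<lambda>x. x + 1) \<mu>) = Delta m \<mu>"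
  by (auto simp: Delta_def pos_roots_def)

lemma G_col_perp_frak_g:
  "G_col_perp (length lam) (frak_g (k + 1) (map (\<lambda>x. x + 1) lam)) = frak_g k lam"
proof -
  let ?l = "length lam"
  let ?a = "katalan (Delta k lam) (Delta (k + 1) lam) (map (\<lambda>x. x + 1) lam)"
  have sub: "Delta k lam \<subseteq> pos_roots ?l" by (auto simp: Delta_def)
  have fg: "frak_g (k + 1) (map (\<lambda>x. x + 1) lam) = ?a"
    by (simp add: frak_g_def Delta_shift)
  have z: "E_op (?l + i) ?a = 0" if "i \<noteq> 0" for i
    by (rule E_op_katalan_shift(2)[OF sub]) (use that in simp)
  \<comment> \<open>All e_(l+i) with i > 0 act as zero, and the coefficient at \<open>i = 0\<close>
    is 1, also for l = 0 by the convention of \<open>G_col_coeff\<close>.\<close>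
  have "G_col_perp ?l ?a = (\<Sum>i\<in>{0}. of_int (G_col_coeff ?l i) * E_op (?l + i) ?a)"
    unfolding G_col_perp_def perp_esum_def perp_esym
    by (rule Sum_any.expand_superset) (use z in auto)
  also have "\<dots> = frak_g k lam"
    by (simp add: G_col_coeff_def E_op_katalan_shift(1)[OF sub] frak_g_def)
  finally show ?thesis unfolding fg .
qed

theorem theorem2p7:
  fixes k l :: nat and lam :: "int list"
  assumes "k \<ge> 1" and "lam \<in> Par k l"
  shows "G_col_perp l (frak_g (k + 1) (map (\<lambda>x. x + 1) lam)) = frak_g k lam \<and>
    ((\<forall>k' l'. \<forall>\<mu> \<in> Par k' l'. k' \<ge> 1 \<longrightarrow> K_k_Schur k' \<mu> = frak_g k' \<mu>) \<longrightarrow>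
      G_col_perp l (K_k_Schur (k + 1) (map (\<lambda>x. x + 1) lam)) = K_k_Schur k lam)"
proof (intro conjI impI)
  have len: "length lam = l" using assms(2) by (simp add: Par_def)
  show main: "G_col_perp l (frak_g (k + 1) (map (\<lambda>x. x + 1) lam)) = frak_g k lam"
    using G_col_perp_frak_g[of lam k] unfolding len .
  assume K: "\<forall>k' l'. \<forall>\<mu> \<in> Par k' l'. k' \<ge> 1 \<longrightarrow> K_k_Schur k' \<mu> = frak_g k' \<mu>"
  have "map (\<lambda>x. x + 1) lam \<in> Par (k + 1) l"
    using assms(2) by (auto simp: Par_def sorted_wrt_map)
  then have "K_k_Schur (k + 1) (map (\<lambda>x. x + 1) lam) = frak_g (k + 1) (map (\<lambda>x. x + 1) lam)"
    using K by (metis le_add2)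
  moreover have "K_k_Schur k lam = frak_g k lam" using K assms by blast
  ultimately show "G_col_perp l (K_k_Schur (k + 1) (map (\<lambda>x. x + 1) lam)) = K_k_Schur k lam"
    using main by simp
qed

end
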